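(* Let $t$ be a positive integer and let $S$ be a skew-symmetric Seidel matrix of order $4t+1$ with spectrum $\{[\pm\sqrt{-4t-3}]^{2t-1},[\pm\sqrt{-3}]^1,[0]^1\}$. Then there exists a vector $\mathbf x\in\{\pm1\}^{4t+1}$ such that the matrix \[\begin{pmatrix} S & \mathbf x\\ -\mathbf x^\top & 0\end{pmatrix}\] is a skew-symmetric Seidel matrix with spectrum $\{[\pm\sqrt{-4t-3}]^{2t},[\pm\sqrt{-1}]^1\}$.
   Context: A Seidel matrix is a square $\{0,\pm1\}$-matrix $S$ with zero diagonal, all off-diagonal entries nonzero, and $S=\pm S^\top$; it is skew-symmetric if $S^\top=-S$. The spectrum is written $\{[\theta_1]^{m_1},\dots,[\theta_r]^{m_r}\}$ where $\theta_i$ are the distinct eigenvalues and $m_i$ their algebraic multiplicities; $[\pm\theta]^m$ means both $\theta$ and $-\theta$ with multiplicity $m$. *)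

theory Defs
  imports "Jordan_Normal_Form.Spectral_Radius"
begin

definition seidel_mat :: "complex mat \<Rightarrow> bool" where
  "seidel_mat S \<longleftrightarrow>
     square_mat S \<and>
     (\<forall>i<dim_row S. \<forall>j<dim_col S. S $$ (i, j) \<in> {0, 1, -1}) \<and>
     (\<forall>i<dim_row S. S $$ (i, i) = 0) \<and>
     (\<forall>i<dim_row S. \<forall>j<dim_col S. i \<noteq> j \<longrightarrow> S $$ (i, j) \<noteq> 0) \<and>
     (S = transpose_mat S \<or> S = - transpose_mat S)"

definition skew_seidel_mat :: "complex mat \<Rightarrow> bool" where
  "skew_seidel_mat S \<longleftrightarrow> seidel_mat S \<and> transpose_mat S = - S"

text \<open>A spectrum with algebraic multiplicities is encoded as the set of all pairs
  (eigenvalue, multiplicity). Each eigenvalue occurs in exactly one pair and the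
  multiplicities are positive, so the bracket notation for a spectrum is the
  corresponding set equation.\<close>

definition mult_spectrum :: "complex mat \<Rightarrow> (complex \<times> nat) set" where
  "mult_spectrum A = {(\<theta>, Polynomial.order \<theta> (char_poly A)) | \<theta>. \<theta> \<in> spectrum A}"

definition pm_mult :: "complex \<Rightarrow> nat \<Rightarrow> (complex \<times> nat) set" where
  "pm_mult \<theta> m = {(\<theta>, m), (- \<theta>, m)}"

end

theory Submission
  imports Defs
begin

text \<open>The integer matrix $G = (4t+3)I + S^2$ is positive semidefinite of rank 3, with diagonal
  entries 3 and odd off-diagonal entries, so it is the Gram matrix of vectors of squared length 3
  in 3-space with inner products $\pm 1, \pm 3$. Comparing the sum of the absolute values of its
  entries with the largest eigenvalue $4t+3$ produces three of these vectors which, up to sign, have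
  pairwise inner products $-1$. They span the diagonals of a cube, and in the orthonormal frame of
  that cube every vector has coordinates $\pm 1$ because its coordinates are integers with squares
  adding up to 3. Hence $G = aa^T + bb^T + cc^T$ with sign vectors $a, b, c$.

  The kernel vector of $S$ forces the inner products of $a, b, c$ to be 1 after changing signs, and
  then $S$ kills $a+b+c$ and acts on its complement in the span as a rotation by a right angle scaled
  by $\sqrt 3$, so that $Sa = \pm(b - c)$. Bordering $S$ by $x = a$ gives a matrix $B$ for which
  $B^2 + (4t+3)I = pp^T + qq^T$ with $p = (b, 1)$, $q = (c, -1)$ orthogonal of squared length $4t+2$,
  which determines the spectrum of $B$.\<close>

subsection \<open>Unitary triangularization\<close>

lemma mat_adjoint_dim [simp]:
  "dim_row (mat_adjoint A) = dim_col A" "dim_col (mat_adjoint A) = dim_row A"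
  by (auto simp: mat_adjoint_def)

lemma mat_adjoint_carrier [simp]:
  "A \<in> carrier_mat m n \<Longrightarrow> mat_adjoint A \<in> carrier_mat n m"
  by (intro carrier_matI) auto

lemma mat_adjoint_index [simp]:
  "i < dim_col A \<Longrightarrow> j < dim_row A \<Longrightarrow> mat_adjoint A $$ (i, j) = conjugate (A $$ (j, i))"
  by (simp add: mat_adjoint_def mat_of_rows_def)

lemma mat_adjoint_mult:
  fixes A B :: "complex mat"
  assumes "A \<in> carrier_mat m n" "B \<in> carrier_mat n k"
  shows "mat_adjoint (A * B) = mat_adjoint B * mat_adjoint A"
  using assms
  by (intro eq_matI) (auto simp: scalar_prod_def mult.commute intro!: sum.cong)

lemma mat_adjoint_four_block:
  fixes A B C D :: "complex mat"
  assumes "A \<in> carrier_mat m k" "B \<in> carrier_mat m l" "C \<in> carrier_mat n k" "D \<in> carrier_mat n l"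
  shows "mat_adjoint (four_block_mat A B C D) =
    four_block_mat (mat_adjoint A) (mat_adjoint C) (mat_adjoint B) (mat_adjoint D)"
  using assms by (intro eq_matI) auto

text \<open>Gram-Schmidt keeps the first vector of a basis that starts with \<open>v\<close>, and
  dividing by the lengths makes the family orthonormal; \<open>c\<close> is the reciprocal of the
  length of \<open>v\<close>. Deflation by an eigenvector needs exactly such a basis.\<close>

lemma unitary_completion:
  fixes v :: "complex vec"
  assumes v: "v \<in> carrier_vec n" and v0: "v \<noteq> 0\<^sub>v n"
  obtains W c where "W \<in> carrier_mat n n" "mat_adjoint W * W = 1\<^sub>m n" "col W 0 = c \<cdot>\<^sub>v v"
proof -
  interpret cof_vec_space n "TYPE(complex)" .
  note bc = basis_completion[OF v v0]
  define ws where "ws = gram_schmidt n (basis_completion v)"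
  have n: "n > 0" using v v0 by (cases n) auto
  have gs: "corthogonal ws" "set ws \<subseteq> carrier_vec n" "length ws = n"
    using gram_schmidt_result[OF bc(2,4,5) ws_def] bc(6) by auto
  obtain vs where "basis_completion v = v # vs"
    using bc(6,7) n by (cases "basis_completion v") auto
  then have "hd ws = v" unfolding ws_def using gram_schmidt_hd[OF v] by simp
  then have ws0: "ws ! 0 = v" using gs(3) n by (cases ws) auto
  have wsc: "ws ! i \<in> carrier_vec n" if "i < n" for i using gs that by auto
  \<comment> \<open>The length comes from a real square root, so that conjugation fixes it.\<close>
  define r where "r i = complex_of_real (sqrt (Re (ws ! i \<bullet>c ws ! i)))" for i
  have r: "r i \<noteq> 0 \<and> r i * r i = ws ! i \<bullet>c ws ! i \<and> cnj (r i) = r i" if i: "i < n" for i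
  proof -
    have "ws ! i \<bullet>c ws ! i \<noteq> 0" using corthogonalD[OF gs(1)] gs(3) i by auto
    moreover have "ws ! i \<bullet>c ws ! i \<ge> 0" by (rule conjugate_square_ge_0_vec)
    ultimately have "Re (ws ! i \<bullet>c ws ! i) > 0" "Im (ws ! i \<bullet>c ws ! i) = 0"
      by (auto simp: less_eq_complex_def complex_eq_iff)
    then show ?thesis
      unfolding r_def by (auto simp: complex_eq_iff)
  qed
  define W where "W = mat n n (\<lambda>(i, j). (ws ! j) $ i / r j)"
  have W: "W \<in> carrier_mat n n" unfolding W_def by simp
  have "mat_adjoint W * W = 1\<^sub>m n"
  proof (rule eq_matI)
    fix i j assume "i < dim_row (1\<^sub>m n)" "j < dim_col (1\<^sub>m n)"
    then have ij: "i < n" "j < n" by auto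
    have "(mat_adjoint W * W) $$ (i, j) =
        (\<Sum>k<n. cnj ((ws ! i) $ k / r i) * ((ws ! j) $ k / r j))"
      using ij W by (simp add: scalar_prod_def W_def atLeast0LessThan)
    also have "\<dots> = (\<Sum>k<n. (ws ! j) $ k * cnj ((ws ! i) $ k)) / (r i * r j)"
      using r[OF ij(1)] by (simp add: sum_divide_distrib mult.commute)
    also have "(\<Sum>k<n. (ws ! j) $ k * cnj ((ws ! i) $ k)) = ws ! j \<bullet>c ws ! i"
      using wsc[OF ij(1)] by (simp add: scalar_prod_def atLeast0LessThan)
    also have "\<dots> / (r i * r j) = (if i = j then 1 else 0)"
      using corthogonalD[OF gs(1), of j i] gs(3) ij r[OF ij(1)] by auto
    finally show "(mat_adjoint W * W) $$ (i, j) = 1\<^sub>m n $$ (i, j)" using ij by simp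
  qed (use W in auto)
  moreover have "col W 0 = (1 / r 0) \<cdot>\<^sub>v v"
    using n v by (intro eq_vecI) (auto simp: W_def ws0)
  ultimately show ?thesis using that W by blast
qed

text \<open>Deflation: a unitary basis starting with an eigenvector for the head \<open>e\<close>
  clears the first column below \<open>e\<close>, and the remaining block has the tail as its
  eigenvalues. The diagonal follows the prescribed order of \<open>es\<close>, because eigenvalues
  are later addressed by position.\<close>

theorem unitary_schur:
  fixes A :: "complex mat"
  assumes "A \<in> carrier_mat n n" "char_poly A = (\<Prod>e\<leftarrow>es. [:- e, 1:])"
  shows "\<exists>U T. U \<in> carrier_mat n n \<and> T \<in> carrier_mat n n \<and> mat_adjoint U * U = 1\<^sub>m n \<and>
    upper_triangular T \<and> diag_mat T = es \<and> A = U * T * mat_adjoint U"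
  using assms
proof (induction es arbitrary: n A)
  case Nil
  with degree_monic_char_poly[of A n] have "n = 0" by auto
  with Nil show ?case
    by (intro exI[of _ A]) (auto simp: diag_mat_def intro!: eq_matI)
next
  case (Cons e es n A)
  let ?m = "n - 1"
  have A: "A \<in> carrier_mat n n" by fact
  have cp: "char_poly A = [:- e, 1:] * (\<Prod>e\<leftarrow>es. [:- e, 1:])" using Cons by simp
  have ev: "eigenvalue A e" unfolding eigenvalue_root_char_poly[OF A] cp by simp
  then obtain v where v: "v \<in> carrier_vec n" "v \<noteq> 0\<^sub>v n" "A *\<^sub>v v = e \<cdot>\<^sub>v v"
    unfolding eigenvalue_def eigenvector_def using A by auto
  have n: "n > 0" using v by (cases n) auto
  obtain W c where W: "W \<in> carrier_mat n n" and WW: "mat_adjoint W * W = 1\<^sub>m n"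
    and col0: "col W 0 = c \<cdot>\<^sub>v v" using unitary_completion[OF v(1,2)] .
  have W': "mat_adjoint W \<in> carrier_mat n n" using W by simp
  have WW': "W * mat_adjoint W = 1\<^sub>m n" by (rule mat_mult_left_right_inverse[OF W' W WW])
  define A' where "A' = mat_adjoint W * A * W"
  have A': "A' \<in> carrier_mat n n" unfolding A'_def using W W' A by (meson mult_carrier_mat)
  have AA': "A = W * A' * mat_adjoint W"
  proof -
    have "W * A' * mat_adjoint W = (W * mat_adjoint W) * A * (W * mat_adjoint W)"
      unfolding A'_def using W W' A by (simp add: assoc_mult_mat[of _ n n _ n _ n] mult_carrier_mat[of _ n n _ n])
    then show ?thesis unfolding WW' using A by simp
  qed
  \<comment> \<open>Column 0 of \<open>A * W\<close> is \<open>e\<close> times column 0 of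
    \<open>W\<close>, and the adjoint of \<open>W\<close> sends column 0 of \<open>W\<close> to the
    first unit vector.\<close>
  have Acol0: "A' $$ (i, 0) = (if i = 0 then e else 0)" if i: "i < n" for i
  proof -
    have "A *\<^sub>v col W 0 = e \<cdot>\<^sub>v col W 0"
      unfolding col0 using v A by (simp add: mult_mat_vec[OF A v(1)] smult_smult_assoc mult.commute)
    then have "col (A * W) 0 = e \<cdot>\<^sub>v col W 0"
      unfolding col_mult2[OF A W n] .
    have "A' $$ (i, 0) = (mat_adjoint W * (A * W)) $$ (i, 0)"
      unfolding A'_def using W W' A by (simp add: assoc_mult_mat[of _ n n _ n _ n] mult_carrier_mat[of _ n n _ n])
    also have "\<dots> = row (mat_adjoint W) i \<bullet> col (A * W) 0"
      using i n W A by simp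
    also have "\<dots> = e * (row (mat_adjoint W) i \<bullet> col W 0)"
      unfolding \<open>col (A * W) 0 = _\<close> using W by simp
    also have "row (mat_adjoint W) i \<bullet> col W 0 = (mat_adjoint W * W) $$ (i, 0)"
      using i n W by simp
    finally show ?thesis using WW i n by simp
  qed
  define A2 where "A2 = mat 1 ?m (\<lambda>(i, j). A' $$ (0, Suc j))"
  define A3 where "A3 = mat ?m ?m (\<lambda>(i, j). A' $$ (Suc i, Suc j))"
  define E where "E = mat 1 1 (\<lambda>_. e)"
  have car: "A2 \<in> carrier_mat 1 ?m" "A3 \<in> carrier_mat ?m ?m" "E \<in> carrier_mat 1 1"
    unfolding A2_def A3_def E_def by auto
  have blk: "A' = four_block_mat E A2 (0\<^sub>m ?m 1) A3"
    using A' n Acol0 by (intro eq_matI) (auto simp: A2_def A3_def E_def)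
  have "similar_mat A' A"
    by (rule similar_matI[of _ _ "mat_adjoint W" W n]) (use W W' A A' WW WW' in \<open>auto simp: A'_def\<close>)
  then have "[:- e, 1:] * (\<Prod>e\<leftarrow>es. [:- e, 1:]) = char_poly A'"
    using cp char_poly_similar by metis
  also have "\<dots> = char_poly E * char_poly A3"
    unfolding blk by (rule char_poly_four_block_zeros_col[OF car(3,1,2)])
  also have "char_poly E = [:- e, 1:]"
    by (simp add: E_def char_poly_defs det_def sign_def)
  finally have "char_poly A3 = (\<Prod>e\<leftarrow>es. [:- e, 1:])"
    by (metis mult_cancel_left pCons_eq_0_iff zero_neq_one)
  from Cons.IH[OF car(2) this] obtain U T where U: "U \<in> carrier_mat ?m ?m"
    and T: "T \<in> carrier_mat ?m ?m" and UU: "mat_adjoint U * U = 1\<^sub>m ?m"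
    and ut: "upper_triangular T" and diag: "diag_mat T = es" and A3: "A3 = U * T * mat_adjoint U"
    by blast
  have U': "mat_adjoint U \<in> carrier_mat ?m ?m" using U by simp
  have UU': "U * mat_adjoint U = 1\<^sub>m ?m" by (rule mat_mult_left_right_inverse[OF U' U UU])
  \<comment> \<open>Extending \<open>U\<close> by a 1 leaves the corner \<open>e\<close> alone. The
    top row of \<open>R\<close> is \<open>A2 * U\<close>, so that the adjoint of \<open>F\<close> on
    the right turns it back into \<open>A2\<close>.\<close>
  define F where "F = four_block_mat (1\<^sub>m 1) (0\<^sub>m 1 ?m) (0\<^sub>m ?m 1) U"
  define R where "R = four_block_mat E (A2 * U) (0\<^sub>m ?m 1) T"
  have adj1: "mat_adjoint (1\<^sub>m 1) = (1\<^sub>m 1 :: complex mat)"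
    "mat_adjoint (0\<^sub>m 1 ?m) = (0\<^sub>m ?m 1 :: complex mat)"
    "mat_adjoint (0\<^sub>m ?m 1) = (0\<^sub>m 1 ?m :: complex mat)"
    by (auto intro!: eq_matI)
  have F': "mat_adjoint F = four_block_mat (1\<^sub>m 1) (0\<^sub>m 1 ?m) (0\<^sub>m ?m 1) (mat_adjoint U)"
    unfolding F_def
    by (subst mat_adjoint_four_block[of _ 1 1 _ ?m _ ?m]) (use U in \<open>auto simp: adj1[simplified]\<close>)
  have F: "F \<in> carrier_mat n n" and R: "R \<in> carrier_mat n n"
    using four_block_carrier_mat[OF one_carrier_mat U, of 1]
      four_block_carrier_mat[OF car(3) T] n unfolding F_def R_def by auto
  have FF: "mat_adjoint F * F = 1\<^sub>m n"
    unfolding F' unfolding F_def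
    by (subst mult_four_block_mat[of _ 1 1 _ ?m _ ?m _ _ 1 _ ?m])
      (use U U' UU n in \<open>auto intro!: eq_matI\<close>)
  have FRF: "F * R * mat_adjoint F = A'"
  proof -
    have "F * R = four_block_mat E (A2 * U) (0\<^sub>m ?m 1) (U * T)"
      unfolding F_def R_def
      by (subst mult_four_block_mat[of _ 1 1 _ ?m _ ?m _ _ 1 _ ?m])
        (use U T car in auto)
    also have "\<dots> * mat_adjoint F = four_block_mat E (A2 * U * mat_adjoint U) (0\<^sub>m ?m 1) A3"
      unfolding F' A3
      by (subst mult_four_block_mat[of _ 1 1 _ ?m _ ?m _ _ 1 _ ?m])
        (use U U' T car in auto)
    also have "A2 * U * mat_adjoint U = A2"
      using car(1) U U' UU' by (simp add: assoc_mult_mat[of _ 1 ?m _ ?m _ ?m])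
    finally show ?thesis unfolding blk .
  qed
  have F'c: "mat_adjoint F \<in> carrier_mat n n" using F by simp
  have adjWF: "mat_adjoint (W * F) = mat_adjoint F * mat_adjoint W"
    by (rule mat_adjoint_mult[OF W F])
  have "mat_adjoint (W * F) * (W * F) = mat_adjoint F * (mat_adjoint W * W) * F"
    unfolding adjWF using W W' F F'c by (simp add: assoc_mult_mat[of _ n n _ n _ n] mult_carrier_mat[of _ n n _ n])
  then have 1: "mat_adjoint (W * F) * (W * F) = 1\<^sub>m n"
    unfolding WW using FF F'c by (metis right_mult_one_mat)
  have "A = W * (F * R * mat_adjoint F) * mat_adjoint W"
    unfolding FRF by (rule AA')
  then have 2: "A = (W * F) * R * mat_adjoint (W * F)"
    unfolding adjWF using W W' F F'c R by (simp add: assoc_mult_mat[of _ n n _ n _ n] mult_carrier_mat[of _ n n _ n])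
  have 3: "upper_triangular R"
    unfolding R_def by (rule upper_triangular_four_block[OF car(3) T _ ut]) (auto simp: E_def)
  have "diag_mat E = [e]" by (simp add: E_def diag_mat_def)
  then have 4: "diag_mat R = e # es"
    unfolding R_def diag_four_block_mat[OF car(3) T] diag by simp
  show ?case using 1 2 3 4 W F R by (intro exI[of _ "W * F"] exI[of _ R]) auto
qed

subsection \<open>Integral Gram matrices of rank three\<close>

lemma sum_three_points:
  fixes f :: "nat \<Rightarrow> int"
  assumes "i < n" "j < n" "k < n"
  shows "(\<Sum>m<n. ((if m = i then p else 0) + (if m = j then q else 0) + (if m = k then r else 0)) * f m)
    = p * f i + q * f j + r * f k"
proof -
  have "(\<Sum>m<n. (if m = l then x else 0) * f m) = x * f l" if "l < n" for l x
  proof -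
    have "(\<Sum>m<n. (if m = l then x else 0) * f m) = (\<Sum>m<n. if m = l then x * f l else 0)"
      by (intro sum.cong) auto
    then show ?thesis using that by simp
  qed
  then show ?thesis using assms by (simp add: distrib_right sum.distrib)
qed

text \<open>The test vector is a sum of three indicator functions, so the indices may coincide; the
  bound on single entries later takes \<open>k = i\<close> with \<open>r = 0\<close>.\<close>

lemma quadratic_form_three_points:
  fixes G :: "nat \<Rightarrow> nat \<Rightarrow> int"
  assumes psd: "\<And>y. 0 \<le> (\<Sum>i<n. \<Sum>j<n. y i * (y j * G i j))"
    and sym: "\<And>i j. i < n \<Longrightarrow> j < n \<Longrightarrow> G i j = G j i"
    and ijk: "i < n" "j < n" "k < n"
  shows "0 \<le> p * p * G i i + q * q * G j j + r * r * G k k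
    + 2 * (p * q * G i j) + 2 * (p * r * G i k) + 2 * (q * r * G j k)"
proof -
  define y where "y m = (if m = i then p else 0) + (if m = j then q else 0) + (if m = k then r else 0)" for m
  have "0 \<le> (\<Sum>l<n. y l * (\<Sum>m<n. y m * G l m))"
    using psd[of y] by (simp add: sum_distrib_left)
  also have "\<dots> = p * (p * G i i + q * G i j + r * G i k) + q * (p * G j i + q * G j j + r * G j k)
      + r * (p * G k i + q * G k j + r * G k k)"
    unfolding y_def sum_three_points[OF ijk] ..
  also have "\<dots> = p * p * G i i + q * q * G j j + r * r * G k k
    + 2 * (p * q * G i j) + 2 * (p * r * G i k) + 2 * (q * r * G j k)"
    using sym[of j i] sym[of k i] sym[of k j] ijk by (simp add: algebra_simps)
  finally show ?thesis .
qed

text \<open>Serves twice: for the coordinates of a vector of squared length 3, and for the mutual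
  inner products of the three sign vectors.\<close>

lemma three_squares_eq_3:
  fixes a b c :: int
  assumes "a * a + b * b + c * c = 3"
  shows "\<bar>a\<bar> = 1" "\<bar>b\<bar> = 1" "\<bar>c\<bar> = 1"
proof -
  have bound: "\<bar>x\<bar> \<le> 1" if "x * x \<le> 3" for x :: int
  proof (rule ccontr)
    assume "\<not> ?thesis"
    then have "2 * 2 \<le> \<bar>x\<bar> * \<bar>x\<bar>" by (intro mult_mono) auto
    then show False using that by simp
  qed
  have sq: "0 \<le> a * a" "0 \<le> b * b" "0 \<le> c * c" by auto
  have "\<bar>a\<bar> \<le> 1" "\<bar>b\<bar> \<le> 1" "\<bar>c\<bar> \<le> 1" by (rule bound, use assms sq in linarith)+
  then have "a = -1 \<or> a = 0 \<or> a = 1" "b = -1 \<or> b = 0 \<or> b = 1" "c = -1 \<or> c = 0 \<or> c = 1" by auto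
  then show "\<bar>a\<bar> = 1" "\<bar>b\<bar> = 1" "\<bar>c\<bar> = 1" using assms by auto
qed

lemma left_right_inverse_sum:
  fixes e f :: "nat \<Rightarrow> nat \<Rightarrow> complex"
  assumes "\<And>p q. p < r \<Longrightarrow> q < r \<Longrightarrow> (\<Sum>l<r. e p l * f l q) = (if p = q then 1 else 0)"
    and "p < r" "q < r"
  shows "(\<Sum>l<r. f p l * e l q) = (if p = q then 1 else 0)"
proof -
  define E where "E = mat r r (\<lambda>(i, j). e i j)"
  define F where "F = mat r r (\<lambda>(i, j). f i j)"
  have car: "E \<in> carrier_mat r r" "F \<in> carrier_mat r r" by (auto simp: E_def F_def)
  have "E * F = 1\<^sub>m r"
    using assms(1) by (intro eq_matI) (auto simp: E_def F_def scalar_prod_def atLeast0LessThan)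
  from mat_mult_left_right_inverse[OF car this] have "(F * E) $$ (p, q) = 1\<^sub>m r $$ (p, q)" by simp
  then show ?thesis using assms(2,3) by (simp add: E_def F_def scalar_prod_def atLeast0LessThan)
qed

text \<open>A left inverse of a square matrix is also a right inverse, so the product of
  \<open>f\<close> and \<open>e\<close> can be inserted between \<open>x\<close> and
  \<open>y\<close>. This expresses an entry of a rank three matrix in the coordinates of a new frame
  and its dual.\<close>

lemma sum_insert_inverse:
  fixes e f :: "nat \<Rightarrow> nat \<Rightarrow> complex"
  assumes "\<And>p q. p < r \<Longrightarrow> q < r \<Longrightarrow> (\<Sum>l<r. e p l * f l q) = (if p = q then 1 else 0)"
  shows "(\<Sum>l<r. x l * y l) = (\<Sum>p<r. (\<Sum>l<r. x l * f l p) * (\<Sum>l<r. e p l * y l))"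
proof -
  have "(\<Sum>p<r. (\<Sum>l<r. x l * f l p) * (\<Sum>l<r. e p l * y l))
      = (\<Sum>p<r. \<Sum>l<r. \<Sum>m<r. x l * (f l p * e p m) * y m)"
    by (simp add: sum_product mult.assoc)
  also have "\<dots> = (\<Sum>l<r. \<Sum>p<r. \<Sum>m<r. x l * (f l p * e p m) * y m)" by (rule sum.swap)
  also have "\<dots> = (\<Sum>l<r. \<Sum>m<r. \<Sum>p<r. x l * (f l p * e p m) * y m)"
    by (intro sum.cong refl sum.swap)
  also have "\<dots> = (\<Sum>l<r. \<Sum>m<r. x l * (\<Sum>p<r. f l p * e p m) * y m)"
    by (simp add: sum_distrib_left sum_distrib_right)
  also have "\<dots> = (\<Sum>l<r. \<Sum>m<r. if l = m then x l * y m else 0)"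
    using left_right_inverse_sum[OF assms] by (intro sum.cong refl) auto
  finally show ?thesis by simp
qed

text \<open>Without such a triangle the signs of a row of \<open>G\<close> switch \<open>G\<close> to the matrix of absolute
  values, whose entries \<open>\<bar>g\<bar> = (g\<^sup>2 + 3) / 4\<close> have a total exceeding \<open>(4t + 3) n\<close>.\<close>

lemma negative_triangle:
  fixes G :: "nat \<Rightarrow> nat \<Rightarrow> int" and t :: nat
  assumes t: "t > 0" and n: "n = 4 * t + 1"
    and small: "\<And>i j. i < n \<Longrightarrow> j < n \<Longrightarrow> \<bar>G i j\<bar> = 1 \<or> \<bar>G i j\<bar> = 3"
    and top: "\<And>y. (\<Sum>i<n. \<Sum>j<n. y i * (y j * G i j)) \<le> (4 * int t + 3) * (\<Sum>i<n. y i * y i)"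
    and frob: "(\<Sum>i<n. \<Sum>j<n. G i j * G i j) = 48 * int t * int t + 24 * int t + 9"
  shows "\<exists>i<n. \<exists>j<n. \<exists>k<n. G i j * G i k * G j k < 0"
proof (rule ccontr)
  assume "\<not> ?thesis"
  then have nonneg: "G i j * G i k * G j k \<ge> 0" if "i < n" "j < n" "k < n" for i j k
    using that by (meson not_less)
  have nz: "G i j \<noteq> 0" if "i < n" "j < n" for i j using small[OF that] by auto
  define y where "y i = sgn (G 0 i)" for i
  have n0: "0 < n" using n by simp
  have yy: "y i * y i = 1" if "i < n" for i
    using nz[OF n0 that] by (auto simp: y_def sgn_if)
  \<comment> \<open>The triangle on 0, \<open>i\<close>, \<open>j\<close> has a positive product, so
    switching by \<open>y\<close> turns the entry into its absolute value; and 4|g| = g^2 + 3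
    whenever |g| is 1 or 3.\<close>
  have abs: "4 * (y i * (y j * G i j)) = G i j * G i j + 3" if "i < n" "j < n" for i j
  proof -
    have "G 0 i * G 0 j * G i j > 0"
      using nonneg[OF n0 that] nz[OF n0 that(1)] nz[OF n0 that(2)] nz[OF that]
      by (metis mult_eq_0_iff order_le_less)
    then have "sgn (G 0 i) * (sgn (G 0 j) * sgn (G i j)) = 1"
      by (simp add: sgn_mult[symmetric] mult.assoc)
    then have "y i * (y j * G i j) = \<bar>G i j\<bar>"
      unfolding y_def by (metis mult.assoc mult.left_neutral mult_sgn_abs)
    moreover have "G i j = 1 \<or> G i j = -1 \<or> G i j = 3 \<or> G i j = -3"
      using small[OF that] by auto
    ultimately show ?thesis by (elim disjE) simp_all
  qed
  have "4 * (\<Sum>i<n. \<Sum>j<n. y i * (y j * G i j)) = (\<Sum>i<n. \<Sum>j<n. G i j * G i j + 3)"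
    by (simp add: sum_distrib_left abs)
  also have "\<dots> = 48 * int t * int t + 24 * int t + 9 + 3 * int n * int n"
    by (simp add: sum.distrib frob)
  finally have "48 * int t * int t + 24 * int t + 9 + 3 * int n * int n \<le> 4 * ((4 * int t + 3) * int n)"
    using top[of y] by (simp add: yy)
  \<comment> \<open>The inequality reads 96t^2 + 48t + 12 <= 64t^2 + 64t + 12.\<close>
  then have "2 * (int t * int t) \<le> int t" unfolding n by (simp add: algebra_simps)
  moreover have "int t * 1 \<le> int t * int t" using t by (intro mult_left_mono) auto
  ultimately show False using t by simp
qed

text \<open>The factorization through three complex coordinates carries no real inner product, so
  the frame of the cube is built twice, as \<open>e\<close> from the rows \<open>w\<close> and as
  \<open>f\<close> from the columns \<open>v\<close>, and biorthogonality of the two replaces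
  orthonormality. The coordinates are half sums of signed entries of \<open>G\<close>, which makes
  them integers by parity.\<close>

lemma gram_as_three_sign_vectors:
  fixes G :: "nat \<Rightarrow> nat \<Rightarrow> int" and t :: nat and w v :: "nat \<Rightarrow> nat \<Rightarrow> complex"
  assumes t: "t > 0" and n: "n = 4 * t + 1"
    and sym: "\<And>i j. i < n \<Longrightarrow> j < n \<Longrightarrow> G i j = G j i"
    and diag: "\<And>i. i < n \<Longrightarrow> G i i = 3"
    and odd: "\<And>i j. i < n \<Longrightarrow> j < n \<Longrightarrow> odd (G i j)"
    and psd: "\<And>y. 0 \<le> (\<Sum>i<n. \<Sum>j<n. y i * (y j * G i j))"
    and top: "\<And>y. (\<Sum>i<n. \<Sum>j<n. y i * (y j * G i j)) \<le> (4 * int t + 3) * (\<Sum>i<n. y i * y i)"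
    and frob: "(\<Sum>i<n. \<Sum>j<n. G i j * G i j) = 48 * int t * int t + 24 * int t + 9"
    and rank: "\<And>i j. i < n \<Longrightarrow> j < n \<Longrightarrow> of_int (G i j) = (\<Sum>l<3. w i l * v l j)"
  shows "\<exists>a b c. (\<forall>i<n. \<bar>a i\<bar> = 1 \<and> \<bar>b i\<bar> = 1 \<and> \<bar>c i\<bar> = 1) \<and>
    (\<forall>i<n. \<forall>j<n. G i j = a i * a j + b i * b j + c i * c j)"
proof -
  have quad: "0 \<le> p * p * G i i + q * q * G j j + r * r * G k k
      + 2 * (p * q * G i j) + 2 * (p * r * G i k) + 2 * (q * r * G j k)"
    if "i < n" "j < n" "k < n" for i j k p q r
    by (rule quadratic_form_three_points[OF psd _ that]) (rule sym)
  have small: "\<bar>G i j\<bar> = 1 \<or> \<bar>G i j\<bar> = 3" if ij: "i < n" "j < n" for i j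
  proof -
    \<comment> \<open>The form at the sum and at the difference of two unit vectors equals 6 plus or
      minus twice the entry.\<close>
    have "\<bar>G i j\<bar> \<le> 3"
      using quad[OF ij ij(1), of 1 1 0] quad[OF ij ij(1), of 1 "-1" 0] diag[OF ij(1)] diag[OF ij(2)]
      by auto
    moreover have "odd \<bar>G i j\<bar>" using odd[OF ij] by simp
    ultimately show ?thesis by presburger
  qed
  obtain i j k where ijk: "i < n" "j < n" "k < n" and neg: "G i j * G i k * G j k < 0"
    using negative_triangle[OF t n small top frob] by auto
  \<comment> \<open>Signs that make the products over the pairs \<open>i\<close>, \<open>j\<close>
    and \<open>i\<close>, \<open>k\<close> negative. A negative triangle then makes the third pair
    negative as well.\<close>
  define p q r :: int where "p = 1" and "q = - sgn (G i j)" and "r = - sgn (G i k)"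
  have sgn_odd: "\<bar>sgn (G i' j')\<bar> = 1" if "i' < n" "j' < n" for i' j'
    using small[OF that] by (auto simp: sgn_if)
  have pm: "p * p = 1" "q * q = 1" "r * r = 1"
    using sgn_odd[OF ijk(1,2)] sgn_odd[OF ijk(1,3)]
    unfolding p_def q_def r_def by (auto simp: abs_if split: if_splits)
  have "sgn (G i j) * sgn (G i k) * sgn (G j k) = -1"
    using neg by (simp add: sgn_mult[symmetric])
  then have "q * r * G j k = - \<bar>G j k\<bar>"
    unfolding q_def r_def
    by (metis (no_types) minus_mult_minus mult.assoc mult_minus1 mult_sgn_abs)
  moreover have "p * q * G i j = - \<bar>G i j\<bar>" "p * r * G i k = - \<bar>G i k\<bar>"
    by (simp_all add: p_def q_def r_def abs_sgn mult.commute)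
  \<comment> \<open>At \<open>p\<close>, \<open>q\<close>, \<open>r\<close> the form is 9 minus
    twice the sum of the three absolute values. That sum is at most 4, so no absolute value can be
    3.\<close>
  ultimately have g: "p * q * G i j = -1" "p * r * G i k = -1" "q * r * G j k = -1"
    using quad[OF ijk, of p q r] small[OF ijk(1,2)] small[OF ijk(1,3)] small[OF ijk(2,3)] pm
      diag[OF ijk(1)] diag[OF ijk(2)] diag[OF ijk(3)] by auto
  \<comment> \<open>If $v_1, v_2, v_3$ have squared length 3 and pairwise inner products $-1$, then
    $(v_1+v_2)/2$, $(v_1+v_3)/2$, $(v_2+v_3)/2$ are orthonormal.\<close>
  define e where "e m l = (if m = 0 then of_int p * w i l + of_int q * w j l
    else if m = 1 then of_int p * w i l + of_int r * w k l
    else of_int q * w j l + of_int r * w k l) / 2" for m l :: nat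
  define f where "f l m = (if m = 0 then of_int p * v l i + of_int q * v l j
    else if m = 1 then of_int p * v l i + of_int r * v l k
    else of_int q * v l j + of_int r * v l k) / 2" for m l :: nat
  \<comment> \<open>\<open>A m\<close>, \<open>B m\<close>, \<open>C m\<close> are twice the
    coordinates of the vector with index \<open>m\<close>. By symmetry of \<open>G\<close> they are
    the same with respect to \<open>f\<close> and to \<open>e\<close>.\<close>
  define A where "A m = p * G i m + q * G j m" for m
  define B where "B m = p * G i m + r * G k m" for m
  define C where "C m = q * G j m + r * G k m" for m
  have three: "{..<3::nat} = {0, 1, 2}" by auto
  have comb: "(\<Sum>l<3. x l * ((P * y l + Q * z l) / 2)) = (P * (\<Sum>l<3. x l * y l) + Q * (\<Sum>l<3. x l * z l)) / 2"
    "(\<Sum>l<3. ((P * y l + Q * z l) / 2) * x l) = (P * (\<Sum>l<3. y l * x l) + Q * (\<Sum>l<3. z l * x l)) / 2"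
    for x y z :: "nat \<Rightarrow> complex" and P Q
    unfolding three by (auto simp: field_simps)
  have ef: "f l 0 = (of_int p * v l i + of_int q * v l j) / 2" "f l 1 = (of_int p * v l i + of_int r * v l k) / 2"
    "f l 2 = (of_int q * v l j + of_int r * v l k) / 2"
    "e 0 l = (of_int p * w i l + of_int q * w j l) / 2" "e 1 l = (of_int p * w i l + of_int r * w k l) / 2"
    "e 2 l = (of_int q * w j l + of_int r * w k l) / 2" for l
    by (simp_all add: e_def f_def)
  have ABC: "(\<Sum>l<3. w m l * f l 0) = of_int (A m) / 2" "(\<Sum>l<3. w m l * f l 1) = of_int (B m) / 2"
    "(\<Sum>l<3. w m l * f l 2) = of_int (C m) / 2"
    "(\<Sum>l<3. e 0 l * v l m) = of_int (A m) / 2" "(\<Sum>l<3. e 1 l * v l m) = of_int (B m) / 2"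
    "(\<Sum>l<3. e 2 l * v l m) = of_int (C m) / 2" if m: "m < n" for m
    unfolding ef comb A_def B_def C_def
    using rank[OF m ijk(1)] rank[OF m ijk(2)] rank[OF m ijk(3)]
      rank[OF ijk(1) m] rank[OF ijk(2) m] rank[OF ijk(3) m]
      sym[OF m ijk(1)] sym[OF m ijk(2)] sym[OF m ijk(3)]
    by simp_all
  have "p * A i = p * p * G i i + p * q * G i j" "q * A j = p * q * G i j + q * q * G j j"
    "r * A k = p * r * G i k + q * r * G j k"
    "p * B i = p * p * G i i + p * r * G i k" "q * B j = p * q * G i j + q * r * G j k"
    "r * B k = p * r * G i k + r * r * G k k"
    "p * C i = p * q * G i j + p * r * G i k" "q * C j = q * q * G j j + q * r * G j k"
    "r * C k = q * r * G j k + r * r * G k k"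
    by (simp_all add: A_def B_def C_def sym[OF ijk(2,1)] sym[OF ijk(3,1)] sym[OF ijk(3,2)] algebra_simps)
  \<comment> \<open>The three signed vectors of the triangle get the coordinates (1, 1, -1), (1, -1,
    1), (-1, 1, 1): vertices of a cube.\<close>
  then have pABC: "p * A i = 2" "q * A j = 2" "r * A k = - 2" "p * B i = 2" "q * B j = - 2"
    "r * B k = 2" "p * C i = - 2" "q * C j = 2" "r * C k = 2"
    unfolding g pm diag[OF ijk(1)] diag[OF ijk(2)] diag[OF ijk(3)] by simp_all
  have lin: "(\<Sum>l<3. e 0 l * f l x) = (of_int p * (\<Sum>l<3. w i l * f l x) + of_int q * (\<Sum>l<3. w j l * f l x)) / 2"
    "(\<Sum>l<3. e 1 l * f l x) = (of_int p * (\<Sum>l<3. w i l * f l x) + of_int r * (\<Sum>l<3. w k l * f l x)) / 2"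
    "(\<Sum>l<3. e 2 l * f l x) = (of_int q * (\<Sum>l<3. w j l * f l x) + of_int r * (\<Sum>l<3. w k l * f l x)) / 2" for x
    unfolding ef comb by simp_all
  have ofs: "complex_of_int x * (of_int y / 2) = of_int (x * y) / 2" for x y by simp
  have inv: "(\<Sum>l<3. e x l * f l y) = (if x = y then 1 else 0)" if "x < 3" "y < 3" for x y
  proof -
    have "x = 0 \<or> x = 1 \<or> x = 2" "y = 0 \<or> y = 1 \<or> y = 2" using that by auto
    then show ?thesis
      by (elim disjE; simp only: lin ABC[OF ijk(1)] ABC[OF ijk(2)] ABC[OF ijk(3)] ofs pABC; simp)
  qed
  have G4: "4 * G x y = A x * A y + B x * B y + C x * C y" if xy: "x < n" "y < n" for x y
  proof -
    have "complex_of_int (G x y) = (\<Sum>m<3. (\<Sum>l<3. w x l * f l m) * (\<Sum>l<3. e m l * v l y))"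
      unfolding rank[OF xy] by (rule sum_insert_inverse[OF inv])
    also have "\<dots> = (\<Sum>l<3. w x l * f l 0) * (\<Sum>l<3. e 0 l * v l y)
        + (\<Sum>l<3. w x l * f l 1) * (\<Sum>l<3. e 1 l * v l y)
        + (\<Sum>l<3. w x l * f l 2) * (\<Sum>l<3. e 2 l * v l y)"
      by (simp add: numeral_3_eq_3 numeral_2_eq_2)
    also have "\<dots> = of_int (A x * A y + B x * B y + C x * C y) / 4"
      by (simp only: ABC[OF xy(1)] ABC[OF xy(2)]) (simp add: field_simps)
    finally have "complex_of_int (4 * G x y) = of_int (A x * A y + B x * B y + C x * C y)"
      by (simp add: mult.commute)
    then show ?thesis by (simp only: of_int_eq_iff)
  qed
  \<comment> \<open>Each of \<open>A\<close>, \<open>B\<close>, \<open>C\<close> adds two odd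
    numbers, so halving stays within the integers.\<close>
  have "odd p" "odd q" "odd r" using pm by (metis even_mult_iff odd_one)+
  then have even: "A x = 2 * (A x div 2)" "B x = 2 * (B x div 2)" "C x = 2 * (C x div 2)"
    if "x < n" for x
    using odd[OF ijk(1) that] odd[OF ijk(2) that] odd[OF ijk(3) that]
    by (auto simp: A_def B_def C_def)
  have G: "G x y = (A x div 2) * (A y div 2) + (B x div 2) * (B y div 2) + (C x div 2) * (C y div 2)"
    if xy: "x < n" "y < n" for x y
  proof -
    have "2 * a * (2 * b) = 4 * (a * b)" for a b :: int by simp
    then have "4 * G x y = 4 * ((A x div 2) * (A y div 2)) + 4 * ((B x div 2) * (B y div 2))
        + 4 * ((C x div 2) * (C y div 2))"
      using G4[OF xy] even[OF xy(1)] even[OF xy(2)] by metis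
    then show ?thesis by simp
  qed
  have "\<bar>A x div 2\<bar> = 1 \<and> \<bar>B x div 2\<bar> = 1 \<and> \<bar>C x div 2\<bar> = 1" if "x < n" for x
    using three_squares_eq_3[of "A x div 2" "B x div 2" "C x div 2"] G[OF that that] diag[OF that]
    by simp
  then show ?thesis
    using G by (intro exI[of _ "\<lambda>x. A x div 2"] exI[of _ "\<lambda>x. B x div 2"] exI[of _ "\<lambda>x. C x div 2"]) simp
qed

subsection \<open>Action of the skew matrix on the three sign vectors\<close>

text \<open>By \<open>G\<close>, applying S twice to any vector only involves its inner products
  with \<open>a\<close>, \<open>b\<close>, \<open>c\<close>. The Frobenius norm restricts the mutual
  inner products of these three to 1 and -1, the kernel vector \<open>z\<close> decides the sign of
  their product, and the length of the image of \<open>a\<close> fixes the one remaining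
  unknown.\<close>

lemma skew_switching_vectors:
  fixes s :: "nat \<Rightarrow> nat \<Rightarrow> int" and t :: nat and a b c :: "nat \<Rightarrow> int" and z :: "nat \<Rightarrow> complex"
  assumes t: "t > 0" and n: "n = 4 * t + 1"
    and skew: "\<And>i j. i < n \<Longrightarrow> j < n \<Longrightarrow> s j i = - s i j"
    and G: "\<And>i j. i < n \<Longrightarrow> j < n \<Longrightarrow>
      (if i = j then 4 * int t + 3 else 0) + (\<Sum>k<n. s i k * s k j) = a i * a j + b i * b j + c i * c j"
    and signs: "\<And>i. i < n \<Longrightarrow> \<bar>a i\<bar> = 1 \<and> \<bar>b i\<bar> = 1 \<and> \<bar>c i\<bar> = 1"
    and frob: "(\<Sum>i<n. \<Sum>j<n. (a i * a j + b i * b j + c i * c j) * (a i * a j + b i * b j + c i * c j)) =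
      48 * int t * int t + 24 * int t + 9"
    and ker: "\<And>i. i < n \<Longrightarrow> (\<Sum>j<n. of_int (s i j) * z j) = 0" and nz: "i0 < n" "z i0 \<noteq> 0"
  shows "\<exists>a' b' c'. (\<forall>i<n. \<bar>a' i\<bar> = 1 \<and> \<bar>b' i\<bar> = 1 \<and> \<bar>c' i\<bar> = 1) \<and>
    (\<forall>i<n. \<forall>j<n. (if i = j then 4 * int t + 3 else 0) + (\<Sum>k<n. s i k * s k j)
      = a' i * a' j + b' i * b' j + c' i * c' j) \<and>
    (\<forall>i<n. (\<Sum>j<n. s i j * a' j) = b' i - c' i) \<and> (\<Sum>i<n. b' i * c' i) = 1"
proof -
  define D where "D x y = (\<Sum>i<n. x i * y i)" for x y :: "nat \<Rightarrow> int"
  define S where "S x i = (\<Sum>j<n. s i j * x j)" for x :: "nat \<Rightarrow> int" and i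
  have Dcom: "D x y = D y x" for x y unfolding D_def by (simp add: mult.commute)
  have Dadd: "D x (\<lambda>i. y i + z i) = D x y + D x z" "D x (\<lambda>i. k * y i) = k * D x y" for x y z k
    unfolding D_def by (simp_all add: sum_distrib_left distrib_left sum.distrib mult.left_commute)
  have Dcong: "D x y = D x z" if "\<And>i. i < n \<Longrightarrow> y i = z i" for x y z
    unfolding D_def using that by simp
  have Sadd: "S (\<lambda>i. y i + z i) = (\<lambda>i. S y i + S z i)" "S (\<lambda>i. k * y i) = (\<lambda>i. k * S y i)" for y z k
    unfolding S_def by (simp_all add: sum_distrib_left distrib_left sum.distrib mult.left_commute)
  have Scong: "S x i = S y i" if "\<And>i. i < n \<Longrightarrow> x i = y i" for x y i
    unfolding S_def using that by simp
  have Dskew: "D x (S y) = - D (S x) y" for x y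
  proof -
    have "D x (S y) = (\<Sum>i<n. \<Sum>j<n. x i * (s i j * y j))"
      unfolding D_def S_def by (simp add: sum_distrib_left)
    also have "\<dots> = (\<Sum>i<n. \<Sum>j<n. - (s j i * x i * y j))"
    proof (intro sum.cong refl)
      fix i j assume "i \<in> {..<n}" "j \<in> {..<n}"
      then have "s i j = - s j i" by (intro skew) auto
      then show "x i * (s i j * y j) = - (s j i * x i * y j)" by simp
    qed
    also have "\<dots> = (\<Sum>j<n. \<Sum>i<n. - (s j i * x i * y j))" by (rule sum.swap)
    also have "\<dots> = - D (S x) y"
      unfolding D_def S_def by (simp add: sum_distrib_right sum_negf)
    finally show ?thesis .
  qed
  have Dself: "D x x = int n" if "\<And>i. i < n \<Longrightarrow> \<bar>x i\<bar> = 1" for x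
  proof -
    have "x i * x i = 1" if "i < n" for i
      using \<open>\<And>i. i < n \<Longrightarrow> \<bar>x i\<bar> = 1\<close>[OF that] by (metis abs_mult_self_eq mult_1)
    then show ?thesis unfolding D_def by simp
  qed
  have SS: "S (S x) i = a i * D a x + b i * D b x + c i * D c x - (4 * int t + 3) * x i" if i: "i < n" for x i
  proof -
    have "S (S x) i = (\<Sum>k<n. \<Sum>j<n. s i k * s k j * x j)"
      unfolding S_def by (simp add: sum_distrib_left mult.assoc)
    also have "\<dots> = (\<Sum>j<n. (\<Sum>k<n. s i k * s k j) * x j)"
      by (subst sum.swap) (simp add: sum_distrib_right)
    also have "\<dots> = (\<Sum>j<n. (a i * a j + b i * b j + c i * c j) * x j - (if i = j then (4 * int t + 3) * x j else 0))"
    proof (intro sum.cong refl)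
      fix j assume "j \<in> {..<n}"
      then have "(\<Sum>k<n. s i k * s k j) = a i * a j + b i * b j + c i * c j - (if i = j then 4 * int t + 3 else 0)"
        using G[of i j] i by simp
      then show "(\<Sum>k<n. s i k * s k j) * x j
          = (a i * a j + b i * b j + c i * c j) * x j - (if i = j then (4 * int t + 3) * x j else 0)"
        by (simp add: left_diff_distrib)
    qed
    also have "\<dots> = a i * D a x + b i * D b x + c i * D c x - (4 * int t + 3) * x i"
      unfolding D_def using i
      by (simp add: sum_subtractf distrib_right sum.distrib sum_distrib_left mult.assoc)
    finally show ?thesis .
  qed
  define \<alpha> \<beta> \<gamma> where "\<alpha> = D a b" and "\<beta> = D a c" and "\<gamma> = D b c"
  have "(\<Sum>i<n. \<Sum>j<n. x i * y i * (x j * y j)) = D x y * D x y" for x y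
    unfolding D_def by (simp add: sum_product)
  moreover have "(a i * a j + b i * b j + c i * c j) * (a i * a j + b i * b j + c i * c j)
      = a i * a i * (a j * a j) + b i * b i * (b j * b j) + c i * c i * (c j * c j)
      + 2 * (a i * b i * (a j * b j)) + 2 * (a i * c i * (a j * c j)) + 2 * (b i * c i * (b j * c j))" for i j
    by (simp add: algebra_simps)
  ultimately have "(\<Sum>i<n. \<Sum>j<n. (a i * a j + b i * b j + c i * c j) * (a i * a j + b i * b j + c i * c j))
      = D a a * D a a + D b b * D b b + D c c * D c c + 2 * (\<alpha> * \<alpha>) + 2 * (\<beta> * \<beta>) + 2 * (\<gamma> * \<gamma>)"
    unfolding \<alpha>_def \<beta>_def \<gamma>_def by (simp add: sum.distrib sum_distrib_left[symmetric])
  \<comment> \<open>The three squared lengths contribute 3(4t + 1)^2 = 48t^2 + 24t + 3, which leaves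
    6 for twice the sum of squares.\<close>
  then have sq: "\<alpha> * \<alpha> + \<beta> * \<beta> + \<gamma> * \<gamma> = 3"
    unfolding frob using Dself[of a] Dself[of b] Dself[of c] signs n by (simp add: algebra_simps)
  note abs1 = three_squares_eq_3[OF sq]
  define y where "y x = (\<Sum>i<n. of_int (x i) * z i)" for x :: "nat \<Rightarrow> int"
  \<comment> \<open>Since S kills \<open>z\<close>, the matrix (4t + 3)I + S^2 multiplies
    \<open>z\<close> by 4t + 3; hence \<open>z\<close> is a combination of \<open>a\<close>,
    \<open>b\<close>, \<open>c\<close> with coefficients proportional to \<open>y a\<close>,
    \<open>y b\<close>, \<open>y c\<close>.\<close>
  have Gz: "of_int (a i) * y a + of_int (b i) * y b + of_int (c i) * y c = (4 * of_nat t + 3) * z i" if i: "i < n" for i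
  proof -
    have "of_int (a i) * y a + of_int (b i) * y b + of_int (c i) * y c
        = (\<Sum>j<n. of_int (a i * a j + b i * b j + c i * c j) * z j)"
      unfolding y_def by (simp add: sum_distrib_left sum.distrib distrib_right mult.assoc)
    also have "\<dots> = (\<Sum>j<n. (if i = j then (4 * of_nat t + 3) * z j else 0)
        + (\<Sum>k<n. of_int (s i k) * (of_int (s k j) * z j)))"
      by (intro sum.cong refl, subst G[symmetric])
        (use i in \<open>auto simp: distrib_right sum_distrib_right mult.assoc\<close>)
    also have "\<dots> = (4 * of_nat t + 3) * z i + (\<Sum>j<n. \<Sum>k<n. of_int (s i k) * (of_int (s k j) * z j))"
      using i by (simp add: sum.distrib)
    also have "(\<Sum>j<n. \<Sum>k<n. of_int (s i k) * (of_int (s k j) * z j))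
        = (\<Sum>k<n. of_int (s i k) * (\<Sum>j<n. of_int (s k j) * z j))"
      by (subst sum.swap) (simp add: sum_distrib_left)
    also have "\<dots> = 0" using ker by simp
    finally show ?thesis by simp
  qed
  have lin: "of_int (D x a) * y a + of_int (D x b) * y b + of_int (D x c) * y c = (4 * of_nat t + 3) * y x" for x
  proof -
    have "of_int (D x a) * y a + of_int (D x b) * y b + of_int (D x c) * y c
        = (\<Sum>i<n. of_int (x i) * (of_int (a i) * y a + of_int (b i) * y b + of_int (c i) * y c))"
      unfolding D_def by (simp add: sum_distrib_right distrib_left sum.distrib mult.assoc)
    also have "\<dots> = (4 * of_nat t + 3) * y x"
      by (simp add: Gz) (simp add: y_def sum_distrib_left mult.left_commute)
    finally show ?thesis .
  qed
  have Dn: "D a a = 4 * int t + 1" "D b b = 4 * int t + 1" "D c c = 4 * int t + 1"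
    using Dself signs n by auto
  have eqs: "of_int \<alpha> * y b + of_int \<beta> * y c = 2 * y a" "of_int \<alpha> * y a + of_int \<gamma> * y c = 2 * y b"
    "of_int \<beta> * y a + of_int \<gamma> * y b = 2 * y c"
    using lin[of a] lin[of b] lin[of c] Dn Dcom[of b a] Dcom[of c a] Dcom[of c b]
    unfolding \<alpha>_def \<beta>_def \<gamma>_def by (simp_all add: algebra_simps)
  have "complex_of_nat (4 * t + 3) \<noteq> 0" by (simp only: of_nat_eq_0_iff)
  then have "(4 * of_nat t + 3) * z i0 \<noteq> 0" using nz(2) by simp
  then have ynz: "y a \<noteq> 0 \<or> y b \<noteq> 0 \<or> y c \<noteq> 0" using Gz[OF nz(1)] by auto
  have pm: "\<alpha> = 1 \<or> \<alpha> = -1" "\<beta> = 1 \<or> \<beta> = -1" "\<gamma> = 1 \<or> \<gamma> = -1" using abs1 by auto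
  \<comment> \<open>By \<open>eqs\<close>, the values \<open>y a\<close>, \<open>y b\<close>,
    \<open>y c\<close> form an eigenvector for 2 of the symmetric matrix with zero diagonal and
    off-diagonal entries \<alpha>, \<beta>, \<gamma>. If their product were -1, its eigenvalues
    would be -2, 1, 1, and all three values would vanish. Real and imaginary parts reduce this to
    linear arithmetic.\<close>
  have prod: "\<gamma> = \<alpha> * \<beta>"
  proof (rule ccontr)
    assume "\<not> ?thesis"
    then have "Re (y x) = 0 \<and> Im (y x) = 0" if "x \<in> {a, b, c}" for x
      using pm that eqs[THEN arg_cong[of _ _ Re]] eqs[THEN arg_cong[of _ _ Im]] by auto
    then show False using ynz by (auto simp: complex_eq_iff)
  qed
  \<comment> \<open>Changing the signs of \<open>b\<close> and \<open>c\<close> preserves their rank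
    one terms and makes all mutual inner products 1.\<close>
  define b' c' where "b' = (\<lambda>i. \<alpha> * b i)" and "c' = (\<lambda>i. \<beta> * c i)"
  have \<alpha>\<beta>: "\<alpha> * \<alpha> = 1" "\<beta> * \<beta> = 1" using pm by auto
  have b'b': "b' i * b' j = b i * b j" "c' i * c' j = c i * c j" for i j
  proof -
    have "b' i * b' j = \<alpha> * \<alpha> * (b i * b j)" "c' i * c' j = \<beta> * \<beta> * (c i * c j)"
      unfolding b'_def c'_def by simp_all
    then show "b' i * b' j = b i * b j" "c' i * c' j = c i * c j" using \<alpha>\<beta> by simp_all
  qed
  have signs': "\<bar>b' i\<bar> = 1" "\<bar>c' i\<bar> = 1" if "i < n" for i
    using signs[OF that] abs1 unfolding b'_def c'_def by (simp_all add: abs_mult)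
  have Db': "D b' x = \<alpha> * D b x" "D c' x = \<beta> * D c x" for x
    unfolding b'_def c'_def D_def by (simp_all add: sum_distrib_left mult.assoc)
  have DD: "D a b' = 1" "D a c' = 1" "D b' c' = 1" "D b' b' = 4 * int t + 1" "D c' c' = 4 * int t + 1"
  proof -
    show ab: "D a b' = 1" "D a c' = 1"
      using Db' Dcom \<alpha>\<beta> unfolding \<alpha>_def \<beta>_def by metis+
    have "D b' c' = \<alpha> * \<beta> * \<gamma>"
      unfolding Db' unfolding Dcom[of b c'] unfolding Db' unfolding Dcom[of c b] \<gamma>_def by simp
    then show "D b' c' = 1" using pm prod by auto
    show "D b' b' = 4 * int t + 1" "D c' c' = 4 * int t + 1" using Dself signs' n by auto
  qed
  have SS': "S (S x) i = a i * D a x + b' i * D b' x + c' i * D c' x - (4 * int t + 3) * x i" if "i < n" for x i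
  proof -
    have "b' i * D b' x = b i * D b x" "c' i * D c' x = c i * D c x"
      unfolding Db' unfolding b'_def c'_def using \<alpha>\<beta>
      by (metis mult.assoc mult.commute mult_1)+
    then show ?thesis using SS[OF that] by simp
  qed
  define u where "u = S a"
  \<comment> \<open>The inner product of \<open>w\<close> with each of the three vectors is 4t + 3,
    so S^2 kills \<open>w\<close>. By skewness the squared length of \<open>S w\<close> is then
    0.\<close>
  define w where "w = (\<lambda>i. a i + (b' i + c' i))"
  have SSw: "S (S w) i = 0" if "i < n" for i
    unfolding SS'[OF that] unfolding w_def Dadd DD Dn Dcom[of b' a] Dcom[of c' a] Dcom[of c' b']
    by (simp add: algebra_simps)
  have "D (S w) (S w) = - D w (S (S w))" using Dskew[of w "S w"] by simp
  also have "D w (S (S w)) = 0" unfolding D_def using SSw by simp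
  finally have "(\<Sum>i<n. S w i * S w i) = 0" unfolding D_def by simp
  then have Sw: "S w i = 0" if "i < n" for i
    using that by (subst (asm) sum_nonneg_eq_0_iff) auto
  define \<mu> where "\<mu> = D b' u"
  \<comment> \<open>The image \<open>u\<close> of \<open>a\<close> is orthogonal to \<open>a\<close>
    by skewness, and to \<open>w\<close> because S kills \<open>w\<close>. So its inner products
    with \<open>b'\<close> and \<open>c'\<close> are opposite.\<close>
  have "D a u = 0" using Dskew[of a a] Dcom[of a "S a"] unfolding u_def by simp
  moreover have "D w u = 0"
    using Dskew[of w a] Sw unfolding u_def D_def by simp
  moreover have "D w u = D a u + (D b' u + D c' u)"
    unfolding Dcom[of w] unfolding w_def Dadd Dcom[of u] ..
  ultimately have Du: "D a u = 0" "D b' u = \<mu>" "D c' u = - \<mu>" unfolding \<mu>_def by auto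
  have SSa: "S u i = w i - 3 * a i" if "i < n" for i
    unfolding u_def SS'[OF that] Dcom[of b' a] Dcom[of c' a] DD Dn w_def by (simp add: algebra_simps)
  \<comment> \<open>S^2 applied to \<open>u\<close> is computed twice: as S applied to w - 3a, which
    gives -3u, and through \<open>SS'\<close>, which gives \<mu>(b' - c') - (4t + 3)u.\<close>
  have u4: "4 * int t * u i = \<mu> * (b' i - c' i)" if i: "i < n" for i
  proof -
    have "S (S u) i = S (\<lambda>i. w i + (-3) * a i) i"
      by (rule Scong) (simp add: SSa)
    also have "\<dots> = - 3 * u i" unfolding Sadd using Sw[OF i] by (simp add: u_def)
    finally show ?thesis using SS'[OF i, of u] unfolding Du by (simp add: algebra_simps)
  qed
  have Duu: "D u u = 8 * int t"
  proof -
    have "D u u = - D a (S u)" using Dskew[of a u] unfolding u_def by simp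
    also have "D a (S u) = D a (\<lambda>i. w i + (-3) * a i)" by (rule Dcong) (simp add: SSa)
    also have "\<dots> = - 8 * int t" unfolding Dadd w_def DD Dn by simp
    finally show ?thesis by simp
  qed
  \<comment> \<open>Both \<open>u\<close> and b' - c' have squared length 8t, so comparing lengths
    in \<open>u4\<close> determines \<mu> up to sign. The sign is absorbed at the end by exchanging
    \<open>b'\<close> and \<open>c'\<close>.\<close>
  have "(4 * int t) * (4 * int t) * (8 * int t) = (\<Sum>i<n. (4 * int t * u i) * (4 * int t * u i))"
    unfolding Duu[symmetric] D_def by (simp add: sum_distrib_left algebra_simps)
  also have "\<dots> = (\<Sum>i<n. \<mu> * (b' i - c' i) * (\<mu> * (b' i - c' i)))"
    using u4 by simp
  also have "\<dots> = \<mu> * \<mu> * (D b' b' + D c' c' - 2 * D b' c')"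
    unfolding D_def by (simp add: sum_distrib_left sum.distrib sum_subtractf algebra_simps)
  also have "\<dots> = \<mu> * \<mu> * (8 * int t)" unfolding DD by simp
  finally have "\<mu> * \<mu> = (4 * int t) * (4 * int t)" using t by simp
  then have "\<mu> = 4 * int t \<or> \<mu> = - (4 * int t)" by (metis square_eq_iff)
  then have "(\<forall>i<n. u i = b' i - c' i) \<or> (\<forall>i<n. u i = c' i - b' i)"
  proof
    assume "\<mu> = 4 * int t"
    then have "4 * int t * u i = 4 * int t * (b' i - c' i)" if "i < n" for i using u4[OF that] by simp
    then show ?thesis using t by simp
  next
    assume "\<mu> = - (4 * int t)"
    then have "4 * int t * u i = 4 * int t * (c' i - b' i)" if "i < n" for i
      using u4[OF that] by (simp add: algebra_simps)
    then show ?thesis using t by simp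
  qed
  then show ?thesis
  proof
    assume "\<forall>i<n. u i = b' i - c' i"
    then show ?thesis using signs signs' G DD(3) unfolding u_def S_def D_def
      by (intro exI[of _ a] exI[of _ b'] exI[of _ c']) (auto simp: b'b')
  next
    assume "\<forall>i<n. u i = c' i - b' i"
    then show ?thesis using signs signs' G DD(3) unfolding u_def S_def D_def
      by (intro exI[of _ a] exI[of _ c'] exI[of _ b']) (auto simp: b'b' mult.commute add.commute add.left_commute)
  qed
qed

subsection \<open>Spectra of skew matrices\<close>

lemma order_prod_linear_factors:
  fixes es :: "'a :: field list"
  shows "order a (\<Prod>e\<leftarrow>es. [:- e, 1:]) = count_list es a"
proof (induction es)
  case (Cons e es)
  have "(\<Prod>e\<leftarrow>es. [:- e, 1:]) \<noteq> 0" by (auto simp: prod_list_zero_iff)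
  then have "order a ([:- e, 1:] * (\<Prod>e\<leftarrow>es. [:- e, 1:])) = order a [:- e, 1:] + count_list es a"
    using Cons by (subst order_mult) (auto simp del: mult_pCons_left)
  moreover have "order a [:- e, 1:] = (if e = a then 1 else 0)"
    using order_power_n_n[of a 1] by (auto intro!: order_0I)
  ultimately show ?case by simp
qed simp

lemma sum_list_count:
  fixes f :: "'a \<Rightarrow> complex"
  assumes "finite X" "set es \<subseteq> X"
  shows "(\<Sum>e\<leftarrow>es. f e) = (\<Sum>x\<in>X. of_nat (count_list es x) * f x)"
  using assms(2)
proof (induction es)
  case (Cons e es)
  have "(\<Sum>x\<in>X. of_nat (count_list (e # es) x) * f x)
      = (\<Sum>x\<in>X. (if x = e then f x else 0) + of_nat (count_list es x) * f x)"
    by (intro sum.cong) (auto simp: distrib_right)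
  then show ?case using Cons assms(1) by (simp add: sum.distrib)
qed simp

lemma spectrum_char_poly_factors:
  fixes A :: "complex mat"
  assumes "A \<in> carrier_mat n n" "char_poly A = (\<Prod>e\<leftarrow>es. [:- e, 1:])"
  shows "spectrum A = set es"
  unfolding spectrum_root_char_poly[OF assms(1)] assms(2) by (induction es) auto

lemma mult_spectrum_factors:
  assumes "A \<in> carrier_mat n n" "char_poly A = (\<Prod>e\<leftarrow>es. [:- e, 1:])"
  shows "mult_spectrum A = (\<lambda>e. (e, count_list es e)) ` set es"
  unfolding mult_spectrum_def spectrum_char_poly_factors[OF assms]
  unfolding assms(2) order_prod_linear_factors by auto

text \<open>The unitary triangular form of a skew-hermitian matrix is again skew-hermitian: zeros
  below the diagonal force zeros above it. So it is diagonal, and column \<open>k\<close> of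
  \<open>u\<close> belongs to \<open>es ! k\<close>. The square is recorded because only the squares
  of the eigenvalues enter the Gram matrix and the trace.\<close>

lemma skew_hermitian_square_diagonalization:
  fixes A :: "complex mat"
  assumes A: "A \<in> carrier_mat n n" and skew: "mat_adjoint A = - A"
    and cp: "char_poly A = (\<Prod>e\<leftarrow>es. [:- e, 1:])"
  obtains u :: "nat \<Rightarrow> nat \<Rightarrow> complex"
  where "\<And>k l. k < n \<Longrightarrow> l < n \<Longrightarrow> (\<Sum>i<n. cnj (u i k) * u i l) = (if k = l then 1 else 0)"
    and "\<And>i j. i < n \<Longrightarrow> j < n \<Longrightarrow> (\<Sum>k<n. u i k * cnj (u j k)) = (if i = j then 1 else 0)"
    and "\<And>i j. i < n \<Longrightarrow> j < n \<Longrightarrow> (A * A) $$ (i, j) = (\<Sum>k<n. (es ! k)\<^sup>2 * (u i k * cnj (u j k)))"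
proof -
  obtain U T where U: "U \<in> carrier_mat n n" and T: "T \<in> carrier_mat n n"
    and UU: "mat_adjoint U * U = 1\<^sub>m n" and ut: "upper_triangular T" and diag: "diag_mat T = es"
    and AT: "A = U * T * mat_adjoint U"
    using unitary_schur[OF A cp] by blast
  let ?U = "mat_adjoint U"
  have U': "?U \<in> carrier_mat n n" using U by simp
  have UU': "U * ?U = 1\<^sub>m n" by (rule mat_mult_left_right_inverse[OF U' U UU])
  note assoc = assoc_mult_mat[of _ n n _ n _ n] mult_carrier_mat[of _ n n _ n]
  have TA: "T = ?U * A * U"
  proof -
    have "?U * A * U = (?U * U) * T * (?U * U)" unfolding AT using U U' T by (simp add: assoc)
    then show ?thesis unfolding UU using T by simp
  qed
  have adjU: "mat_adjoint ?U = U" using U by (intro eq_matI) auto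
  have "mat_adjoint T = ?U * (- A) * U"
    unfolding TA using U U' A
    by (simp add: mat_adjoint_mult[of _ n n _ n] adjU skew assoc)
  also have "\<dots> = - T" unfolding TA using U U' A by simp
  finally have adjT: "mat_adjoint T = - T" .
  have len: "length es = n" using diag T by (auto simp: diag_mat_def)
  have Tij: "T $$ (i, j) = (if i = j then es ! i else 0)" if ij: "i < n" "j < n" for i j
  proof (cases i j rule: linorder_cases)
    case less
    have "mat_adjoint T $$ (i, j) = - T $$ (i, j)" unfolding adjT using T ij by simp
    moreover have "T $$ (j, i) = 0" using ut less ij T by auto
    ultimately show ?thesis using T ij less by simp
  next
    case equal
    then show ?thesis using diag T ij by (auto simp: diag_mat_def)
  next
    case greater
    then show ?thesis using ut T ij by auto
  qed
  have "A * A = U * T * (?U * U) * T * ?U" unfolding AT using U U' T by (simp add: assoc)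
  also have "\<dots> = U * (T * T) * ?U" unfolding UU using U U' T by (simp add: assoc)
  finally have AA: "A * A = U * (T * T) * ?U" .
  have TT: "(T * T) $$ (k, l) = (if k = l then (es ! k)\<^sup>2 else 0)" if "k < n" "l < n" for k l
  proof -
    have "(T * T) $$ (k, l) = (\<Sum>m<n. T $$ (k, m) * T $$ (m, l))"
      using T that by (simp add: scalar_prod_def atLeast0LessThan)
    also have "\<dots> = (\<Sum>m<n. if k = m then (if k = l then (es ! k)\<^sup>2 else 0) else 0)"
      by (intro sum.cong refl) (use that in \<open>auto simp: Tij power2_eq_square\<close>)
    finally show ?thesis using that by simp
  qed
  have UTT: "(U * (T * T)) $$ (i, k) = (es ! k)\<^sup>2 * U $$ (i, k)" if "i < n" "k < n" for i k
  proof -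
    have "(U * (T * T)) $$ (i, k) = (\<Sum>m<n. U $$ (i, m) * (T * T) $$ (m, k))"
      using U T that by (subst index_mult_mat(1)) (auto simp: scalar_prod_def atLeast0LessThan)
    also have "\<dots> = (\<Sum>m<n. if k = m then (es ! k)\<^sup>2 * U $$ (i, k) else 0)"
      by (intro sum.cong refl) (use that in \<open>auto simp: TT\<close>)
    finally show ?thesis using that by simp
  qed
  have 3: "(A * A) $$ (i, j) = (\<Sum>k<n. (es ! k)\<^sup>2 * (U $$ (i, k) * cnj (U $$ (j, k))))"
    if "i < n" "j < n" for i j
  proof -
    have "(A * A) $$ (i, j) = (\<Sum>k<n. (U * (T * T)) $$ (i, k) * ?U $$ (k, j))"
      unfolding AA using U T that by (subst index_mult_mat(1)) (auto simp: scalar_prod_def atLeast0LessThan)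
    also have "\<dots> = (\<Sum>k<n. (es ! k)\<^sup>2 * (U $$ (i, k) * cnj (U $$ (j, k))))"
      by (intro sum.cong refl) (use that U in \<open>auto simp: UTT\<close>)
    finally show ?thesis .
  qed
  have 1: "(\<Sum>i<n. cnj (U $$ (i, k)) * U $$ (i, l)) = (if k = l then 1 else 0)" if "k < n" "l < n" for k l
    using arg_cong[OF UU, of "\<lambda>M. M $$ (k, l)"] that U by (simp add: scalar_prod_def atLeast0LessThan)
  have 2: "(\<Sum>k<n. U $$ (i, k) * cnj (U $$ (j, k))) = (if i = j then 1 else 0)" if "i < n" "j < n" for i j
    using arg_cong[OF UU', of "\<lambda>M. M $$ (i, j)"] that U by (simp add: scalar_prod_def atLeast0LessThan)
  show thesis by (rule that[of "\<lambda>i k. U $$ (i, k)"]) (fact 1 2 3)+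
qed

text \<open>The orthogonal vectors \<open>p\<close>, \<open>q\<close> of squared length m = 4t + 2
  are eigenvectors of B^2 for m - (4t + 3) = -1, and on their complement B^2 is -(4t + 3). Symmetry
  of the spectrum under negation leaves two unknown multiplicities, which the size of B and the
  trace of B^2 determine.\<close>

lemma mult_spectrum_skew_two_squares:
  fixes B :: "complex mat" and p q :: "nat \<Rightarrow> complex" and t :: nat
  assumes t: "t > 0" and m: "m = 4 * t + 2" and B: "B \<in> carrier_mat m m"
    and skew: "transpose_mat B = - B" and adj: "mat_adjoint B = - B"
    and BB: "\<And>i j. i < m \<Longrightarrow> j < m \<Longrightarrow>
      (B * B) $$ (i, j) + (if i = j then 4 * of_nat t + 3 else 0) = p i * p j + q i * q j"
    and pp: "(\<Sum>i<m. p i * p i) = of_nat m" and qq: "(\<Sum>i<m. q i * q i) = of_nat m"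
    and pq: "(\<Sum>i<m. p i * q i) = 0"
  shows "mult_spectrum B = pm_mult (csqrt (- 4 * of_nat t - 3)) (2 * t) \<union> pm_mult (csqrt (- 1)) 1"
proof -
  define \<kappa> where "\<kappa> = csqrt (- 4 * of_nat t - 3)"
  define \<iota> where "\<iota> = csqrt (- 1)"
  have \<kappa>2: "\<kappa>\<^sup>2 = - 4 * of_nat t - 3" and \<iota>2: "\<iota>\<^sup>2 = -1" unfolding \<kappa>_def \<iota>_def by (simp_all only: power2_csqrt)
  have nz: "(4 * of_nat t + 3 :: complex) \<noteq> 0" "(4 * of_nat t + 2 :: complex) \<noteq> 0"
    using of_nat_eq_0_iff[of "4 * t + 3", where 'a = complex]
      of_nat_eq_0_iff[of "4 * t + 2", where 'a = complex] by (auto simp: add.commute)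
  obtain es where cp: "char_poly B = (\<Prod>e\<leftarrow>es. [:- e, 1:])" and len: "length es = m"
    using char_poly_factorized[OF B] by blast
  \<comment> \<open>Transposition keeps the characteristic polynomial, while here it is also
    negation, which reflects the spectrum.\<close>
  have sym: "count_list es (- x) = count_list es x" for x
  proof -
    have "- B = (-1) \<cdot>\<^sub>m B" by (intro eq_matI) auto
    then have "order x (char_poly (- B)) = order (- x) (char_poly B)"
      using order_char_poly_smult[OF B, of "-1" x] by simp
    moreover have "char_poly (- B) = char_poly B" using char_poly_transpose_mat[OF B] skew by simp
    ultimately show ?thesis using cp by (simp add: order_prod_linear_factors)
  qed
  have ev: "e\<^sup>2 = \<kappa>\<^sup>2 \<or> e\<^sup>2 = \<iota>\<^sup>2" if "e \<in> set es" for e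
  proof -
    have "eigenvalue B e" using spectrum_char_poly_factors[OF B cp] that by (auto simp: spectrum_def)
    then obtain v where v: "v \<in> carrier_vec m" "v \<noteq> 0\<^sub>v m" "B *\<^sub>v v = e \<cdot>\<^sub>v v"
      unfolding eigenvalue_def eigenvector_def using B by auto
    have "(B * B) *\<^sub>v v = B *\<^sub>v (B *\<^sub>v v)" using B v(1) by simp
    also have "\<dots> = e\<^sup>2 \<cdot>\<^sub>v v"
      unfolding v(3) using mult_mat_vec[OF B v(1)] v by (simp add: smult_smult_assoc power2_eq_square)
    finally have BBv: "(B * B) *\<^sub>v v = e\<^sup>2 \<cdot>\<^sub>v v" .
    define P Q where "P = (\<Sum>j<m. p j * v $ j)" and "Q = (\<Sum>j<m. q j * v $ j)"
    have main: "(e\<^sup>2 + (4 * of_nat t + 3)) * v $ i = p i * P + q i * Q" if i: "i < m" for i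
    proof -
      have "e\<^sup>2 * v $ i = ((B * B) *\<^sub>v v) $ i" unfolding BBv using v(1) i by simp
      also have "\<dots> = (\<Sum>j<m. (B * B) $$ (i, j) * v $ j)"
        using B v(1) i by (subst index_mult_mat_vec) (auto simp: scalar_prod_def atLeast0LessThan)
      also have "\<dots> = (\<Sum>j<m. (p i * p j + q i * q j) * v $ j
          - (if i = j then (4 * of_nat t + 3) * v $ j else 0))"
      proof (intro sum.cong refl)
        fix j assume "j \<in> {..<m}"
        then have "(B * B) $$ (i, j) = p i * p j + q i * q j - (if i = j then 4 * of_nat t + 3 else 0)"
          using BB[OF i, of j] by (simp add: eq_diff_eq del: index_mult_mat(1))
        then show "(B * B) $$ (i, j) * v $ j = (p i * p j + q i * q j) * v $ j
            - (if i = j then (4 * of_nat t + 3) * v $ j else 0)"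
          by (simp add: left_diff_distrib del: index_mult_mat(1))
      qed
      also have "\<dots> = p i * P + q i * Q - (4 * of_nat t + 3) * v $ i"
        unfolding P_def Q_def using i
        by (simp add: sum_subtractf distrib_right sum.distrib sum_distrib_left mult.assoc)
      finally show ?thesis by (simp add: algebra_simps)
    qed
    \<comment> \<open>Pairing \<open>main\<close> with \<open>p\<close> and with \<open>q\<close>
      isolates \<open>P\<close> and \<open>Q\<close>: if one of them is nonzero, e^2 + 4t + 3 equals
      \<open>m\<close>.\<close>
    have proj: "(e\<^sup>2 + (4 * of_nat t + 3)) * (\<Sum>i<m. r i * v $ i)
        = (\<Sum>i<m. r i * p i) * P + (\<Sum>i<m. r i * q i) * Q" for r
    proof -
      have "(e\<^sup>2 + (4 * of_nat t + 3)) * (\<Sum>i<m. r i * v $ i)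
          = (\<Sum>i<m. r i * ((e\<^sup>2 + (4 * of_nat t + 3)) * v $ i))"
        by (simp add: sum_distrib_left mult.left_commute)
      then show ?thesis by (simp add: main distrib_left sum.distrib sum_distrib_right mult.assoc)
    qed
    have qp: "(\<Sum>i<m. q i * p i) = 0" using pq by (simp add: mult.commute)
    show ?thesis
    proof (cases "P = 0 \<and> Q = 0")
      case True
      obtain i where i: "i < m" "v $ i \<noteq> 0" using v(1,2) by (metis carrier_vecD eq_vecI index_zero_vec)
      then have "e\<^sup>2 + (4 * of_nat t + 3) = 0" using main[OF i(1)] True by simp
      then show ?thesis unfolding \<kappa>2 by (simp add: algebra_simps eq_neg_iff_add_eq_0)
    next
      case False
      then have "e\<^sup>2 + (4 * of_nat t + 3) = of_nat m"
        using proj[of p] proj[of q] unfolding pp qq pq qp P_def[symmetric] Q_def[symmetric] by auto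
      then show ?thesis unfolding \<iota>2 m by (simp add: algebra_simps eq_neg_iff_add_eq_0)
    qed
  qed
  define X where "X = {\<kappa>, - \<kappa>, \<iota>, - \<iota>}"
  have sub: "set es \<subseteq> X" using ev unfolding X_def power2_eq_iff by blast
  have ne: "\<kappa>\<^sup>2 \<noteq> \<iota>\<^sup>2" 
  proof
    assume "\<kappa>\<^sup>2 = \<iota>\<^sup>2"
    moreover have "\<iota>\<^sup>2 - \<kappa>\<^sup>2 = 4 * of_nat t + 2" unfolding \<kappa>2 \<iota>2 by simp
    ultimately show False using nz(2) by simp
  qed
  have "- \<kappa>\<^sup>2 \<noteq> 0" using nz(1) unfolding \<kappa>2 by (simp add: add.commute)
  then have "\<kappa> \<noteq> 0" by auto
  moreover have "\<iota> \<noteq> 0" using \<iota>2 by auto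
  ultimately have dist: "\<kappa> \<noteq> - \<kappa>" "\<iota> \<noteq> - \<iota>" "\<kappa> \<noteq> \<iota>" "\<kappa> \<noteq> - \<iota>" "- \<kappa> \<noteq> \<iota>"
    using ne by (auto simp: power2_eq_iff)
  define x y where "x = count_list es \<kappa>" and "y = count_list es \<iota>"
  \<comment> \<open>Used with the identity for the trace of B^2 and with the constant 1 for the size
    of B.\<close>
  have sumX: "(\<Sum>e\<leftarrow>es. g (e\<^sup>2)) = of_nat (2 * x) * g (\<kappa>\<^sup>2) + of_nat (2 * y) * g (\<iota>\<^sup>2)" for g :: "complex \<Rightarrow> complex"
  proof -
    have "\<kappa> \<notin> {- \<kappa>, \<iota>, - \<iota>}" "- \<kappa> \<notin> {\<iota>, - \<iota>}" "\<iota> \<notin> {- \<iota>}"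
      using dist by auto
    then have "(\<Sum>e\<in>X. h e) = h \<kappa> + (h (- \<kappa>) + (h \<iota> + h (- \<iota>)))" for h :: "complex \<Rightarrow> complex"
      unfolding X_def by simp
    note expand = this
    have "finite X" unfolding X_def by simp
    from sum_list_count[OF this sub, of "\<lambda>e. g (e\<^sup>2)"]
    have "(\<Sum>e\<leftarrow>es. g (e\<^sup>2)) = of_nat x * g (\<kappa>\<^sup>2) + (of_nat x * g (\<kappa>\<^sup>2)
        + (of_nat y * g (\<iota>\<^sup>2) + of_nat y * g (\<iota>\<^sup>2)))"
      unfolding expand x_def y_def sym power2_minus .
    then show ?thesis by (simp add: distrib_right)
  qed
  obtain u where u: "\<And>k l. k < m \<Longrightarrow> l < m \<Longrightarrow> (\<Sum>i<m. cnj (u i k) * u i l) = (if k = l then 1 else 0)"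
    and "\<And>i j. i < m \<Longrightarrow> j < m \<Longrightarrow> (\<Sum>k<m. u i k * cnj (u j k)) = (if i = j then 1 else 0)"
    and BBu: "\<And>i j. i < m \<Longrightarrow> j < m \<Longrightarrow> (B * B) $$ (i, j) = (\<Sum>k<m. (es ! k)\<^sup>2 * (u i k * cnj (u j k)))"
    by (rule skew_hermitian_square_diagonalization[OF B adj cp]) blast
  have "(\<Sum>e\<leftarrow>es. e\<^sup>2) = (\<Sum>k<m. (es ! k)\<^sup>2)"
    by (simp add: sum_list_sum_nth len atLeast0LessThan)
  also have "\<dots> = (\<Sum>k<m. (es ! k)\<^sup>2 * (\<Sum>i<m. cnj (u i k) * u i k))"
    using u by simp
  also have "\<dots> = (\<Sum>i<m. \<Sum>k<m. (es ! k)\<^sup>2 * (u i k * cnj (u i k)))"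
    by (subst sum.swap) (simp add: sum_distrib_left mult.commute)
  also have "\<dots> = (\<Sum>i<m. (B * B) $$ (i, i))" by (simp add: BBu del: index_mult_mat(1))
  \<comment> \<open>The trace read off the diagonal is 2m - m(4t + 3) = -m(4t + 1).\<close>
  also have "\<dots> = (\<Sum>i<m. p i * p i + q i * q i - (4 * of_nat t + 3))"
  proof (intro sum.cong refl)
    fix i assume "i \<in> {..<m}"
    then show "(B * B) $$ (i, i) = p i * p i + q i * q i - (4 * of_nat t + 3)"
      using BB[of i i] by (simp add: eq_diff_eq del: index_mult_mat(1))
  qed
  also have "\<dots> = - of_nat (m * (4 * t + 1))"
    by (simp add: sum.distrib sum_subtractf pp qq algebra_simps)
  finally have "of_nat (2 * x) * \<kappa>\<^sup>2 + of_nat (2 * y) * \<iota>\<^sup>2 = - of_nat (m * (4 * t + 1))"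
    using sumX[of "\<lambda>z. z"] by simp
  then have "complex_of_nat (2 * x * (4 * t + 3) + 2 * y) = of_nat (m * (4 * t + 1))"
    unfolding \<kappa>2 \<iota>2 by (simp add: algebra_simps)
  then have 1: "2 * x * (4 * t + 3) + 2 * y = m * (4 * t + 1)" by (simp only: of_nat_eq_iff)
  have "(\<Sum>e\<leftarrow>es. (1::complex)) = of_nat m" by (simp add: sum_list_triv len)
  then have "complex_of_nat (2 * x + 2 * y) = of_nat m"
    using sumX[of "\<lambda>_. 1"] by simp
  then have 2: "2 * x + 2 * y = m" by (simp only: of_nat_eq_iff)
  \<comment> \<open>Subtracting the second count from the first leaves 2x(4t + 2) = 4tm.\<close>
  have "(4 * t + 2) * (2 * x) = (4 * t + 2) * (4 * t)"
    using 1 2 unfolding m by (simp add: algebra_simps)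
  then have x: "x = 2 * t" unfolding mult_cancel1 by simp
  with 2 m have y: "y = 1" by simp
  \<comment> \<open>All four candidates really occur, because both multiplicities are positive for
    \<open>t > 0\<close>.\<close>
  have "X \<subseteq> set es"
  proof -
    have mem: "e \<in> set es" if "count_list es e \<noteq> 0" for e
      using that by (metis count_list_0_iff)
    show ?thesis
      unfolding X_def using x y t by (auto intro!: mem simp: sym simp flip: x_def y_def)
  qed
  with sub have "set es = X" by blast
  then show ?thesis
    unfolding mult_spectrum_factors[OF B cp] pm_mult_def \<kappa>_def[symmetric] \<iota>_def[symmetric]
    using x y by (simp add: X_def sym x_def y_def insert_commute)
qed

text \<open>The pairs of eigenvalue and multiplicity determine the multiset of linear factors. The
  list \<open>es\<close> may therefore be arranged in any convenient order.\<close>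

lemma char_poly_eqI_mult_spectrum:
  assumes "A \<in> carrier_mat n n" "mult_spectrum A = (\<lambda>e. (e, count_list es e)) ` set es"
  shows "char_poly A = (\<Prod>e\<leftarrow>es. [:- e, 1:])"
proof -
  obtain es' where cp: "char_poly A = (\<Prod>e\<leftarrow>es'. [:- e, 1:])"
    using char_poly_factorized[OF assms(1)] by blast
  have img: "(\<lambda>e. (e, count_list es' e)) ` set es' = (\<lambda>e. (e, count_list es e)) ` set es"
    using mult_spectrum_factors[OF assms(1) cp] assms(2) by simp
  then have "fst ` (\<lambda>e. (e, count_list es' e)) ` set es' = fst ` (\<lambda>e. (e, count_list es e)) ` set es"
    by simp
  then have set: "set es' = set es" by (simp add: image_image)
  have "count_list es' e = count_list es e" for e
  proof (cases "e \<in> set es")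
    case True
    then have "(e, count_list es e) \<in> (\<lambda>e. (e, count_list es' e)) ` set es'" unfolding img by blast
    then show ?thesis by auto
  next
    case False
    with set show ?thesis by (simp add: count_list_0_iff)
  qed
  then have mset: "mset es' = mset es" by (intro multiset_eqI) (simp add: count_mset)
  have "(\<Prod>e\<leftarrow>es'. [:- e, 1:]) = prod_mset (image_mset (\<lambda>e. [:- e, 1:]) (mset es'))"
    by (simp flip: prod_mset_prod_list)
  also have "\<dots> = (\<Prod>e\<leftarrow>es. [:- e, 1:])"
    unfolding mset by (simp flip: prod_mset_prod_list)
  finally show ?thesis using cp by simp
qed

lemma count_list_replicate: "count_list (replicate n x) y = (if x = y then n else 0)"
  by (induction n) auto

section \<open>Quadratic form and Frobenius norm of the Gram matrix\<close>

lemma gram_form_nonneg: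
  fixes G :: "nat \<Rightarrow> nat \<Rightarrow> int" and u :: "nat \<Rightarrow> nat \<Rightarrow> complex" and d :: "nat \<Rightarrow> nat"
  assumes "\<And>i j. i < n \<Longrightarrow> j < n \<Longrightarrow> of_int (G i j) = (\<Sum>l<r. of_nat (d l) * (u i l * cnj (u j l)))"
  shows "0 \<le> (\<Sum>i<n. \<Sum>j<n. y i * (y j * G i j))"
proof -
  define c where "c l = (\<Sum>i<n. of_int (y i) * u i l)" for l
  have "complex_of_int (\<Sum>i<n. \<Sum>j<n. y i * (y j * G i j))
      = (\<Sum>i<n. \<Sum>j<n. \<Sum>l<r. of_nat (d l) * ((of_int (y i) * u i l) * (of_int (y j) * cnj (u j l))))"
    by (simp add: assms sum_distrib_left mult_ac)
  also have "\<dots> = (\<Sum>i<n. \<Sum>l<r. \<Sum>j<n. of_nat (d l) * ((of_int (y i) * u i l) * (of_int (y j) * cnj (u j l))))"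
    by (intro sum.cong refl sum.swap)
  also have "\<dots> = (\<Sum>l<r. \<Sum>i<n. \<Sum>j<n. of_nat (d l) * ((of_int (y i) * u i l) * (of_int (y j) * cnj (u j l))))"
    by (rule sum.swap)
  \<comment> \<open>The form splits into squared moduli of the components \<open>c l\<close>,
    weighted by the nonnegative \<open>d l\<close>.\<close>
  also have "\<dots> = (\<Sum>l<r. of_nat (d l) * (c l * cnj (c l)))"
    unfolding c_def cnj_sum sum_product by (simp add: sum_distrib_left)
  also have "\<dots> = of_real (\<Sum>l<r. of_nat (d l) * (cmod (c l))\<^sup>2)"
    by (simp add: complex_norm_square[symmetric])
  finally have "complex_of_real (of_int (\<Sum>i<n. \<Sum>j<n. y i * (y j * G i j)))
      = of_real (\<Sum>l<r. of_nat (d l) * (cmod (c l))\<^sup>2)" by simp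
  then have "real_of_int (\<Sum>i<n. \<Sum>j<n. y i * (y j * G i j)) = (\<Sum>l<r. of_nat (d l) * (cmod (c l))\<^sup>2)"
    by (simp only: of_real_eq_iff)
  also have "\<dots> \<ge> 0" by (intro sum_nonneg) simp
  finally show ?thesis by (simp only: of_int_0_le_iff)
qed

text \<open>The orthonormal columns of \<open>u\<close> are eigenvectors of \<open>G\<close> with
  eigenvalues \<open>d l\<close>, and for symmetric \<open>G\<close> the sum of squared entries is
  the trace of G^2.\<close>

lemma gram_frobenius:
  fixes G :: "nat \<Rightarrow> nat \<Rightarrow> int" and u :: "nat \<Rightarrow> nat \<Rightarrow> complex" and d :: "nat \<Rightarrow> nat"
  assumes G: "\<And>i j. i < n \<Longrightarrow> j < n \<Longrightarrow> of_int (G i j) = (\<Sum>l<r. of_nat (d l) * (u i l * cnj (u j l)))"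
    and sym: "\<And>i j. i < n \<Longrightarrow> j < n \<Longrightarrow> G i j = G j i"
    and u: "\<And>k l. k < r \<Longrightarrow> l < r \<Longrightarrow> (\<Sum>i<n. cnj (u i k) * u i l) = (if k = l then 1 else 0)"
  shows "(\<Sum>i<n. \<Sum>j<n. G i j * G i j) = (\<Sum>l<r. int (d l) * int (d l))"
proof -
  have ev: "(\<Sum>j<n. cnj (u j l) * of_int (G j i)) = of_nat (d l) * cnj (u i l)" if "l < r" "i < n" for l i
  proof -
    have "(\<Sum>j<n. cnj (u j l) * of_int (G j i))
        = (\<Sum>j<n. \<Sum>m<r. of_nat (d m) * cnj (u i m) * (cnj (u j l) * u j m))"
      using that by (simp add: G sum_distrib_left mult_ac)
    also have "\<dots> = (\<Sum>m<r. of_nat (d m) * cnj (u i m) * (\<Sum>j<n. cnj (u j l) * u j m))"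
      by (subst sum.swap) (simp add: sum_distrib_left)
    also have "\<dots> = (\<Sum>m<r. if l = m then of_nat (d l) * cnj (u i l) else 0)"
      by (intro sum.cong refl) (use u that in auto)
    finally show ?thesis using that by simp
  qed
  have row: "(\<Sum>j<n. of_int (G i j) * of_int (G i j))
      = (\<Sum>l<r. (of_nat (d l) * of_nat (d l)) * (cnj (u i l) * u i l))" if i: "i < n" for i
  proof -
    have "(\<Sum>j<n. complex_of_int (G i j) * of_int (G i j))
        = (\<Sum>j<n. (\<Sum>l<r. of_nat (d l) * (u i l * cnj (u j l))) * of_int (G j i))"
    proof (intro sum.cong refl)
      fix j assume "j \<in> {..<n}"
      then have "j < n" by simp
      then show "complex_of_int (G i j) * of_int (G i j)
          = (\<Sum>l<r. of_nat (d l) * (u i l * cnj (u j l))) * of_int (G j i)"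
        using G[OF i] sym[OF i] by metis
    qed
    also have "\<dots> = (\<Sum>j<n. \<Sum>l<r. of_nat (d l) * u i l * (cnj (u j l) * of_int (G j i)))"
      by (simp add: sum_distrib_right mult.assoc)
    also have "\<dots> = (\<Sum>l<r. of_nat (d l) * u i l * (\<Sum>j<n. cnj (u j l) * of_int (G j i)))"
      by (subst sum.swap) (simp add: sum_distrib_left)
    also have "\<dots> = (\<Sum>l<r. (of_nat (d l) * of_nat (d l)) * (cnj (u i l) * u i l))"
      by (intro sum.cong refl) (use ev i in \<open>auto simp: mult_ac\<close>)
    finally show ?thesis .
  qed
  have "complex_of_int (\<Sum>i<n. \<Sum>j<n. G i j * G i j)
      = (\<Sum>i<n. \<Sum>l<r. (of_nat (d l) * of_nat (d l)) * (cnj (u i l) * u i l))"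
    using row by simp
  also have "\<dots> = (\<Sum>l<r. (of_nat (d l) * of_nat (d l)) * (\<Sum>i<n. cnj (u i l) * u i l))"
    by (subst sum.swap) (simp add: sum_distrib_left)
  also have "\<dots> = of_int (\<Sum>l<r. int (d l) * int (d l))" using u by simp
  finally show ?thesis by (simp only: of_int_eq_iff)
qed

text \<open>By skewness the form of cI + S^2 at \<open>y\<close> is c|y|^2 - |Sy|^2. This bounds the
  form without reference to the spectrum.\<close>

lemma skew_square_form_le:
  fixes s :: "nat \<Rightarrow> nat \<Rightarrow> int"
  assumes skew: "\<And>i j. i < n \<Longrightarrow> j < n \<Longrightarrow> s j i = - s i j"
  shows "(\<Sum>i<n. \<Sum>j<n. y i * (y j * ((if i = j then c else 0) + (\<Sum>k<n. s i k * s k j)))) \<le> c * (\<Sum>i<n. y i * y i)"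
proof -
  have "(\<Sum>i<n. \<Sum>j<n. y i * (y j * ((if i = j then c else 0) + (\<Sum>k<n. s i k * s k j))))
      = (\<Sum>i<n. \<Sum>j<n. (if i = j then c * (y i * y i) else 0) - (\<Sum>k<n. (s k i * y i) * (s k j * y j)))"
  proof (intro sum.cong refl)
    fix i j assume i: "i \<in> {..<n}" and j: "j \<in> {..<n}"
    have "s i k * s k j = - (s k i * s k j)" if "k < n" for k
      using skew[of k i] i that by simp
    then have "(\<Sum>k<n. s i k * s k j) = - (\<Sum>k<n. s k i * s k j)" by (simp add: sum_negf)
    then show "y i * (y j * ((if i = j then c else 0) + (\<Sum>k<n. s i k * s k j)))
        = (if i = j then c * (y i * y i) else 0) - (\<Sum>k<n. (s k i * y i) * (s k j * y j))"
      by (simp add: right_diff_distrib sum_distrib_left mult_ac)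
  qed
  also have "\<dots> = c * (\<Sum>i<n. y i * y i) - (\<Sum>i<n. \<Sum>j<n. \<Sum>k<n. (s k i * y i) * (s k j * y j))"
    by (simp add: sum_subtractf sum_distrib_left)
  also have "(\<Sum>i<n. \<Sum>j<n. \<Sum>k<n. (s k i * y i) * (s k j * y j))
      = (\<Sum>i<n. \<Sum>k<n. \<Sum>j<n. (s k i * y i) * (s k j * y j))"
    by (intro sum.cong refl sum.swap)
  also have "\<dots> = (\<Sum>k<n. \<Sum>i<n. \<Sum>j<n. (s k i * y i) * (s k j * y j))" by (rule sum.swap)
  also have "\<dots> = (\<Sum>k<n. (\<Sum>i<n. s k i * y i) * (\<Sum>j<n. s k j * y j))" by (simp add: sum_product)
  also have "c * (\<Sum>i<n. y i * y i) - \<dots> \<le> c * (\<Sum>i<n. y i * y i)"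
    by (simp add: sum_nonneg)
  finally show ?thesis .
qed

subsection \<open>The bordered matrix\<close>

lemma of_int_mat_mult_index:
  assumes "M \<in> carrier_mat n n" "\<And>i j. i < n \<Longrightarrow> j < n \<Longrightarrow> M $$ (i, j) = complex_of_int (f i j)"
    and "i < n" "j < n"
  shows "(M * M) $$ (i, j) = of_int (\<Sum>k<n. f i k * f k j)"
  using assms by (simp add: scalar_prod_def atLeast0LessThan)

lemma skew_seidel_matI:
  assumes M: "M \<in> carrier_mat n n"
    and entries: "\<And>i j. i < n \<Longrightarrow> j < n \<Longrightarrow> M $$ (i, j) = complex_of_int (f i j)"
    and skew: "\<And>i j. i < n \<Longrightarrow> j < n \<Longrightarrow> f j i = - f i j"
    and unit: "\<And>i j. i < n \<Longrightarrow> j < n \<Longrightarrow> i \<noteq> j \<Longrightarrow> \<bar>f i j\<bar> = 1"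
  shows "skew_seidel_mat M" "transpose_mat M = - M" "mat_adjoint M = - M"
proof -
  show tr: "transpose_mat M = - M"
  proof (rule eq_matI)
    fix i j assume "i < dim_row (- M)" "j < dim_col (- M)"
    then have ij: "i < n" "j < n" using M by auto
    show "transpose_mat M $$ (i, j) = (- M) $$ (i, j)"
      using ij M entries[OF ij] entries[OF ij(2,1)] skew[OF ij] by simp
  qed (use M in auto)
  show "mat_adjoint M = - M"
  proof (rule eq_matI)
    fix i j assume "i < dim_row (- M)" "j < dim_col (- M)"
    then have ij: "i < n" "j < n" using M by auto
    show "mat_adjoint M $$ (i, j) = (- M) $$ (i, j)"
      using ij M entries[OF ij] entries[OF ij(2,1)] skew[OF ij] by simp
  qed (use M in auto)
  have M': "M = - transpose_mat M" unfolding tr using M by (intro eq_matI) auto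
  have diag: "f i i = 0" if "i < n" for i using skew[OF that that] by simp
  have cases: "f i j = 0 \<and> i = j \<or> (f i j = 1 \<or> f i j = -1)" if "i < n" "j < n" for i j
    using unit[OF that] diag[OF that(1)] by (cases "i = j") auto
  have "M $$ (i, j) \<in> {0, 1, -1}" "i \<noteq> j \<Longrightarrow> M $$ (i, j) \<noteq> 0" if "i < n" "j < n" for i j
    using cases[OF that] unit[OF that] entries[OF that] by auto
  moreover have "M $$ (i, i) = 0" if "i < n" for i
    using entries[OF that that] diag[OF that] by simp
  ultimately show "skew_seidel_mat M"
    unfolding skew_seidel_mat_def seidel_mat_def using M M' tr by auto
qed

text \<open>In the upper left block of B^2 the border subtracts the rank one term of
  \<open>a\<close>, leaving those of \<open>b\<close> and \<open>c\<close>. In the border, S a = b -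
  c is the product of these vectors with the extra coordinates 1 and -1. In the corner, 4t + 3 - n =
  2 is the sum of their squares.\<close>

lemma bordered_skew_seidel:
  fixes s :: "nat \<Rightarrow> nat \<Rightarrow> int" and t :: nat and a b c :: "nat \<Rightarrow> int"
  assumes t: "t > 0" and n: "n = 4 * t + 1" and S: "S \<in> carrier_mat n n"
    and entries: "\<And>i j. i < n \<Longrightarrow> j < n \<Longrightarrow> S $$ (i, j) = complex_of_int (s i j)"
    and skew: "\<And>i j. i < n \<Longrightarrow> j < n \<Longrightarrow> s j i = - s i j"
    and unit: "\<And>i j. i < n \<Longrightarrow> j < n \<Longrightarrow> i \<noteq> j \<Longrightarrow> \<bar>s i j\<bar> = 1"
    and signs: "\<And>i. i < n \<Longrightarrow> \<bar>a i\<bar> = 1 \<and> \<bar>b i\<bar> = 1 \<and> \<bar>c i\<bar> = 1"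
    and G: "\<And>i j. i < n \<Longrightarrow> j < n \<Longrightarrow>
      (if i = j then 4 * int t + 3 else 0) + (\<Sum>k<n. s i k * s k j) = a i * a j + b i * b j + c i * c j"
    and Sa: "\<And>i. i < n \<Longrightarrow> (\<Sum>j<n. s i j * a j) = b i - c i" and bc: "(\<Sum>i<n. b i * c i) = 1"
  defines "x \<equiv> vec n (\<lambda>i. complex_of_int (a i))"
  defines "B \<equiv> four_block_mat S (transpose_mat (mat_of_row x)) (- mat_of_row x) (0\<^sub>m 1 1)"
  shows "skew_seidel_mat B"
    "mult_spectrum B = pm_mult (csqrt (- 4 * of_nat t - 3)) (2 * t) \<union> pm_mult (csqrt (- 1)) 1"
proof -
  define m where "m = Suc n"
  define f where "f i j = (if i < n then if j < n then s i j else a i else if j < n then - a j else 0)" for i j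
  define p where "p i = (if i < n then b i else 1)" for i
  define q where "q i = (if i < n then c i else -1)" for i
  have B: "B \<in> carrier_mat m m" unfolding B_def m_def x_def using S by (intro carrier_matI) auto
  have Bf: "B $$ (i, j) = complex_of_int (f i j)" if "i < m" "j < m" for i j
    using that S entries unfolding B_def m_def f_def x_def
    by (auto simp: mat_of_row_def)
  have fskew: "f j i = - f i j" if "i < m" "j < m" for i j
  proof (cases "i < n \<and> j < n")
    case True
    then show ?thesis using skew[of i j] unfolding f_def by simp
  next
    case False
    then show ?thesis using that unfolding f_def m_def by auto
  qed
  have funit: "\<bar>f i j\<bar> = 1" if "i < m" "j < m" "i \<noteq> j" for i j
    using unit signs that unfolding f_def m_def by auto
  note Bskew = skew_seidel_matI[OF B Bf fskew funit]
  show "skew_seidel_mat B" by (rule Bskew(1))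
  have sq: "x * x = 1" if "\<bar>x\<bar> = 1" for x :: int
    using that abs_mult_self_eq[of x] by simp
  have FF: "(if i = j then 4 * int t + 3 else 0) + (\<Sum>k<m. f i k * f k j) = p i * p j + q i * q j"
    if ij: "i < m" "j < m" for i j
  proof -
    consider "i < n" "j < n" | "i < n" "j = n" | "i = n" "j < n" | "i = n" "j = n"
      using ij unfolding m_def by linarith
    then show ?thesis
    proof cases
      case 1
      then have "(\<Sum>k<m. f i k * f k j) = (\<Sum>k<n. s i k * s k j) - a i * a j"
        unfolding m_def by (simp add: f_def)
      then show ?thesis using G[OF 1] 1 by (simp add: p_def q_def)
    next
      case 2
      then have "(\<Sum>k<m. f i k * f k j) = (\<Sum>k<n. s i k * a k)"
        unfolding m_def by (simp add: f_def)
      then show ?thesis using Sa[OF 2(1)] 2 by (simp add: p_def q_def)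
    next
      case 3
      then have "(\<Sum>k<m. f i k * f k j) = (\<Sum>k<n. - (a k * s k j))"
        unfolding m_def by (simp add: f_def)
      also have "\<dots> = (\<Sum>k<n. s j k * a k)"
      proof (intro sum.cong refl)
        fix k assume "k \<in> {..<n}"
        then have "s k j = - s j k" using 3 by (intro skew) auto
        then show "- (a k * s k j) = s j k * a k" by simp
      qed
      finally show ?thesis using Sa[OF 3(2)] 3 by (simp add: p_def q_def)
    next
      case 4
      have "(\<Sum>k<m. f i k * f k j) = (\<Sum>k<n. - (a k * a k))"
        using 4 unfolding m_def by (simp add: f_def)
      also have "\<dots> = - int n" using signs sq by simp
      finally show ?thesis using 4 n by (simp add: p_def q_def)
    qed
  qed
  have BB: "(B * B) $$ (i, j) + (if i = j then 4 * of_nat t + 3 else 0)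
      = complex_of_int (p i) * of_int (p j) + of_int (q i) * of_int (q j)" if ij: "i < m" "j < m" for i j
  proof -
    have "(B * B) $$ (i, j) + (if i = j then 4 * of_nat t + 3 else 0)
        = complex_of_int ((if i = j then 4 * int t + 3 else 0) + (\<Sum>k<m. f i k * f k j))"
      by (subst of_int_mat_mult_index[OF B Bf ij]) simp_all
    then show ?thesis unfolding FF[OF ij] by simp
  qed
  \<comment> \<open>The extra coordinates raise both squared lengths from \<open>n\<close> to
    \<open>m\<close> and cancel the inner product 1 of \<open>b\<close> and
    \<open>c\<close>.\<close>
  have inner: "(\<Sum>i<m. p i * p i) = int m" "(\<Sum>i<m. q i * q i) = int m" "(\<Sum>i<m. p i * q i) = 0"
    unfolding m_def p_def q_def using signs sq bc by simp_all
  have "(\<Sum>i<m. complex_of_int (p i) * of_int (p i)) = of_int (\<Sum>i<m. p i * p i)"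
    "(\<Sum>i<m. complex_of_int (q i) * of_int (q i)) = of_int (\<Sum>i<m. q i * q i)"
    "(\<Sum>i<m. complex_of_int (p i) * of_int (q i)) = of_int (\<Sum>i<m. p i * q i)"
    by simp_all
  note inner' = this[unfolded inner]
  have m: "m = 4 * t + 2" unfolding m_def n by simp
  show "mult_spectrum B = pm_mult (csqrt (- 4 * of_nat t - 3)) (2 * t) \<union> pm_mult (csqrt (- 1)) 1"
    by (rule mult_spectrum_skew_two_squares[OF t m B Bskew(2,3) BB]) (use inner' in auto)
qed

text \<open>An odd number 4t - 1 of odd terms remains. This is the shape of an off-diagonal entry of
  S^2, where the terms at \<open>i\<close> and \<open>j\<close> contain a diagonal entry of
  S.\<close>

lemma odd_unit_sum:
  fixes g :: "nat \<Rightarrow> int"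
  assumes "n = 4 * t + 1" "i < n" "j < n" "i \<noteq> j" "g i = 0" "g j = 0"
    "\<And>k. k < n \<Longrightarrow> k \<noteq> i \<Longrightarrow> k \<noteq> j \<Longrightarrow> \<bar>g k\<bar> = 1"
  shows "odd (\<Sum>k<n. g k)"
proof -
  have o: "odd (g k) \<longleftrightarrow> k \<noteq> i \<and> k \<noteq> j" if "k < n" for k
    using assms(5,6) assms(7)[OF that] by (metis dvd_0_right dvd_abs_iff odd_one)
  have "{k \<in> {..<n}. odd (g k)} = {..<n} - {i, j}" using o by auto
  then have "card {k \<in> {..<n}. odd (g k)} = n - 2" using assms by (simp add: card_Diff_subset)
  moreover have "odd (n - 2)" if "t > 0" using assms(1) that by presburger
  \<comment> \<open>Two distinct indices below \<open>n\<close> exclude \<open>t = 0\<close>, where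
    \<open>n - 2\<close> would be truncated to 0.\<close>
  moreover have "t > 0" using assms(1-4) by (cases t) auto
  ultimately show ?thesis by (simp add: even_sum_iff)
qed

section \<open>From the given spectrum to the Gram matrix conditions and the border\<close>

theorem theorem4p14:
  fixes t :: nat and S :: "complex mat"
  assumes "t > 0"
    and "S \<in> carrier_mat (4 * t + 1) (4 * t + 1)"
    and "skew_seidel_mat S"
    and "mult_spectrum S =
           pm_mult (csqrt (- 4 * of_nat t - 3)) (2 * t - 1) \<union> pm_mult (csqrt (- 3)) 1 \<union> {(0, 1)}"
  shows "\<exists>x \<in> carrier_vec (4 * t + 1).
           (\<forall>i < 4 * t + 1. x $ i \<in> {1, - 1}) \<and>
           (let B = four_block_mat S (transpose_mat (mat_of_row x)) (- mat_of_row x) (0\<^sub>m 1 1) in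
              skew_seidel_mat B \<and>
              mult_spectrum B = pm_mult (csqrt (- 4 * of_nat t - 3)) (2 * t) \<union> pm_mult (csqrt (- 1)) 1)"
proof -
  define n where "n = 4 * t + 1"
  have t: "t > 0" and S: "S \<in> carrier_mat n n" using assms unfolding n_def by auto
  \<comment> \<open>Entries are 0, 1 or -1, so the floor of the real part recovers them as
    integers.\<close>
  define s where "s i j = \<lfloor>Re (S $$ (i, j))\<rfloor>" for i j
  have Svals: "S $$ (i, j) \<in> {0, 1, -1}" "i \<noteq> j \<Longrightarrow> S $$ (i, j) \<noteq> 0" if "i < n" "j < n" for i j
    using assms(3) that S unfolding skew_seidel_mat_def seidel_mat_def by auto
  have floor_m1: "\<lfloor>- 1 :: real\<rfloor> = - 1" by (simp add: floor_unique)
  have entries: "S $$ (i, j) = complex_of_int (s i j)" if "i < n" "j < n" for i j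
    using Svals(1)[OF that] unfolding s_def by (auto simp: floor_m1)
  have skew: "s j i = - s i j" if "i < n" "j < n" for i j
  proof -
    have "transpose_mat S $$ (i, j) = (- S) $$ (i, j)"
      using assms(3) unfolding skew_seidel_mat_def by simp
    then have "S $$ (j, i) = - S $$ (i, j)" using that S by simp
    then have "complex_of_int (s j i) = of_int (- s i j)"
      using entries[OF that] entries[OF that(2,1)] by simp
    then show ?thesis by (simp only: of_int_eq_iff)
  qed
  have unit: "\<bar>s i j\<bar> = 1" if "i < n" "j < n" "i \<noteq> j" for i j
    using Svals(1)[OF that(1,2)] Svals(2)[OF that] unfolding s_def by (auto simp: floor_m1)
  have sdiag: "s i i = 0" if "i < n" for i using skew[OF that that] by simp
  have adj: "mat_adjoint S = - S" by (rule skew_seidel_matI(3)[OF S entries skew unit])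
  define \<kappa> where "\<kappa> = csqrt (- 4 * of_nat t - 3)"
  define \<rho> where "\<rho> = csqrt (- 3)"
  have \<kappa>2: "\<kappa>\<^sup>2 = - 4 * of_nat t - 3" and \<rho>2: "\<rho>\<^sup>2 = -3" unfolding \<kappa>_def \<rho>_def by (simp_all only: power2_csqrt)
  have nz: "(4 * of_nat t + 3 :: complex) \<noteq> 0"
    using of_nat_eq_0_iff[of "4 * t + 3", where 'a = complex] by (auto simp: add.commute)
  have "- \<kappa>\<^sup>2 \<noteq> 0" using nz unfolding \<kappa>2 by (simp add: add.commute)
  then have \<kappa>0: "\<kappa> \<noteq> 0" by auto
  have \<rho>0: "\<rho> \<noteq> 0" using \<rho>2 by auto
  have "\<rho>\<^sup>2 - \<kappa>\<^sup>2 = 4 * of_nat t" unfolding \<rho>2 \<kappa>2 by simp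
  then have "\<kappa>\<^sup>2 \<noteq> \<rho>\<^sup>2" using t by auto
  then have dist: "\<kappa> \<noteq> \<rho>" "\<kappa> \<noteq> - \<rho>" "- \<kappa> \<noteq> \<rho>" by auto
  \<comment> \<open>The eigenvalues 0, \<rho>, -\<rho> come first, so that exactly the first three
    positions contribute to \<open>G\<close>.\<close>
  define es where "es = [0, \<rho>, - \<rho>] @ replicate (2 * t - 1) \<kappa> @ replicate (2 * t - 1) (- \<kappa>)"
  have "2 * t - 1 \<noteq> 0" using t by simp
  then have set_es: "set es = {\<kappa>, - \<kappa>, \<rho>, - \<rho>, 0}" unfolding es_def by auto
  have counts: "count_list es \<kappa> = 2 * t - 1" "count_list es (- \<kappa>) = 2 * t - 1"
    "count_list es \<rho> = 1" "count_list es (- \<rho>) = 1" "count_list es 0 = 1"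
    unfolding es_def using \<kappa>0 \<rho>0 dist by (auto simp: count_list_replicate)
  have "mult_spectrum S = (\<lambda>e. (e, count_list es e)) ` set es"
    unfolding assms(4) pm_mult_def set_es \<kappa>_def[symmetric] \<rho>_def[symmetric] by (simp add: counts insert_commute)
  then have cp: "char_poly S = (\<Prod>e\<leftarrow>es. [:- e, 1:])" by (rule char_poly_eqI_mult_spectrum[OF S])
  obtain u where u: "\<And>k l. k < n \<Longrightarrow> l < n \<Longrightarrow> (\<Sum>i<n. cnj (u i k) * u i l) = (if k = l then 1 else 0)"
    and uu: "\<And>i j. i < n \<Longrightarrow> j < n \<Longrightarrow> (\<Sum>k<n. u i k * cnj (u j k)) = (if i = j then 1 else 0)"
    and SS: "\<And>i j. i < n \<Longrightarrow> j < n \<Longrightarrow> (S * S) $$ (i, j) = (\<Sum>k<n. (es ! k)\<^sup>2 * (u i k * cnj (u j k)))"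
    by (rule skew_hermitian_square_diagonalization[OF S adj cp]) blast
  define G where "G i j = (if i = j then 4 * int t + 3 else 0) + (\<Sum>k<n. s i k * s k j)" for i j
  \<comment> \<open>The nonzero eigenvalues of \<open>G\<close>: 4t + 3 from the eigenvalue 0 of S,
    and 4t + 3 - 3 = 4t from each of \<rho> and -\<rho>.\<close>
  define d where "d l = (if l = 0 then 4 * t + 3 else 4 * t)" for l :: nat
  have n3: "3 < n" unfolding n_def using t by simp
  have high: "(es ! k)\<^sup>2 + (4 * of_nat t + 3) = 0" if "3 \<le> k" "k < n" for k
  proof -
    have "es ! k = (replicate (2 * t - 1) \<kappa> @ replicate (2 * t - 1) (- \<kappa>)) ! (k - 3)"
      unfolding es_def using that(1) by (subst nth_append) (simp add: numeral_3_eq_3)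
    also have "\<dots> \<in> set (replicate (2 * t - 1) \<kappa> @ replicate (2 * t - 1) (- \<kappa>))"
      by (rule nth_mem) (use that in \<open>auto simp: n_def\<close>)
    finally have "es ! k = \<kappa> \<or> es ! k = - \<kappa>" by auto
    then show ?thesis using \<kappa>2 by auto
  qed
  have low: "(es ! k)\<^sup>2 + (4 * of_nat t + 3) = of_nat (d k)" if "k < 3" for k
  proof -
    have "k = 0 \<or> k = 1 \<or> k = 2" using that by auto
    then show ?thesis unfolding es_def d_def using \<rho>2 by (auto simp: numeral_2_eq_2)
  qed
  have merge: "r * (\<Sum>k<n. h k) + (\<Sum>k<n. g k * h k) = (\<Sum>k<n. (g k + r) * h k)"
    for r :: complex and g h :: "nat \<Rightarrow> complex"
    by (simp add: distrib_right sum.distrib sum_distrib_left)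
  have Gu: "of_int (G i j) = (\<Sum>l<3. of_nat (d l) * (u i l * cnj (u j l)))" if ij: "i < n" "j < n" for i j
  proof -
    have "complex_of_int (G i j) = (4 * of_nat t + 3) * (if i = j then 1 else 0) + (S * S) $$ (i, j)"
      by (subst of_int_mat_mult_index[OF S entries ij]) (simp_all add: G_def)
    also have "\<dots> = (\<Sum>k<n. ((es ! k)\<^sup>2 + (4 * of_nat t + 3)) * (u i k * cnj (u j k)))"
      unfolding SS[OF ij] uu[OF ij, symmetric] by (rule merge)
    also have "\<dots> = (\<Sum>k<3. ((es ! k)\<^sup>2 + (4 * of_nat t + 3)) * (u i k * cnj (u j k)))"
      by (rule sum.mono_neutral_right) (use n3 high in auto)
    also have "\<dots> = (\<Sum>l<3. of_nat (d l) * (u i l * cnj (u j l)))"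
      by (intro sum.cong refl) (use low in auto)
    finally show ?thesis .
  qed
  have sym: "G i j = G j i" if "i < n" "j < n" for i j
  proof -
    have "s i k * s k j = s j k * s k i" if "k < n" for k
    proof -
      have "s i k = - s k i" "s k j = - s j k" by (intro skew; fact)+
      then show ?thesis by simp
    qed
    then show ?thesis unfolding G_def by simp
  qed
  have sq: "x * x = 1" if "\<bar>x\<bar> = 1" for x :: int
    using that abs_mult_self_eq[of x] by simp
  have diag: "G i i = 3" if i: "i < n" for i
  proof -
    \<comment> \<open>Every term is -1 except the one at \<open>k = i\<close>, so the sum is
      -4t.\<close>
    have "(\<Sum>k<n. s i k * s k i) = (\<Sum>k<n. (if k = i then 1 else 0) - 1)"
    proof (intro sum.cong refl)
      fix k assume "k \<in> {..<n}"
      then have k: "k < n" by simp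
      have "s k i = - s i k" by (intro skew; fact)
      then show "s i k * s k i = (if k = i then 1 else 0) - 1"
        using sq[OF unit[OF i k]] sdiag[OF i] by auto
    qed
    also have "\<dots> = 1 - int n" using i by (simp add: sum_subtractf)
    finally show ?thesis unfolding G_def n_def by simp
  qed
  have odd: "odd (G i j)" if ij: "i < n" "j < n" for i j
  proof (cases "i = j")
    case True
    then show ?thesis using diag ij by simp
  next
    case False
    have "odd (\<Sum>k<n. s i k * s k j)"
      by (rule odd_unit_sum[OF n_def ij False]) (use sdiag ij unit in \<open>auto simp: abs_mult\<close>)
    then show ?thesis using False unfolding G_def by simp
  qed
  have psd: "0 \<le> (\<Sum>i<n. \<Sum>j<n. y i * (y j * G i j))" for y
    by (rule gram_form_nonneg[OF Gu])
  have top: "(\<Sum>i<n. \<Sum>j<n. y i * (y j * G i j)) \<le> (4 * int t + 3) * (\<Sum>i<n. y i * y i)" for y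
    unfolding G_def by (rule skew_square_form_le[OF skew])
  \<comment> \<open>The squared eigenvalues add up to (4t + 3)^2 + 2(4t)^2.\<close>
  have "(\<Sum>i<n. \<Sum>j<n. G i j * G i j) = (\<Sum>l<3. int (d l) * int (d l))"
    by (rule gram_frobenius[OF Gu sym u]) (use n3 in auto)
  also have "\<dots> = 48 * int t * int t + 24 * int t + 9"
    by (simp add: numeral_3_eq_3 d_def algebra_simps)
  finally have frob: "(\<Sum>i<n. \<Sum>j<n. G i j * G i j) = 48 * int t * int t + 24 * int t + 9" .
  have rank: "of_int (G i j) = (\<Sum>l<3. (of_nat (d l) * u i l) * cnj (u j l))" if "i < n" "j < n" for i j
    unfolding Gu[OF that] by (simp add: mult.assoc)
  have "\<exists>a b c. (\<forall>i<n. \<bar>a i\<bar> = 1 \<and> \<bar>b i\<bar> = 1 \<and> \<bar>c i\<bar> = 1) \<and>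
      (\<forall>i<n. \<forall>j<n. G i j = a i * a j + b i * b j + c i * c j)"
    by (rule gram_as_three_sign_vectors[OF t n_def sym diag odd psd top frob rank])
  then obtain a b c where signs: "\<And>i. i < n \<Longrightarrow> \<bar>a i\<bar> = 1 \<and> \<bar>b i\<bar> = 1 \<and> \<bar>c i\<bar> = 1"
    and Gabc: "\<And>i j. i < n \<Longrightarrow> j < n \<Longrightarrow> G i j = a i * a j + b i * b j + c i * c j"
    by blast
  have "eigenvalue S 0"
    using spectrum_char_poly_factors[OF S cp] set_es unfolding spectrum_def by auto
  then obtain v where v: "v \<in> carrier_vec n" "v \<noteq> 0\<^sub>v n" "S *\<^sub>v v = 0 \<cdot>\<^sub>v v"
    unfolding eigenvalue_def eigenvector_def using S by auto
  obtain i0 where i0: "i0 < n" "v $ i0 \<noteq> 0" using v(1,2) by (metis carrier_vecD eq_vecI index_zero_vec)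
  have ker: "(\<Sum>j<n. of_int (s i j) * v $ j) = 0" if i: "i < n" for i
  proof -
    have "(S *\<^sub>v v) $ i = 0" unfolding v(3) using v(1) i by simp
    then show ?thesis using S v(1) i entries by (simp add: scalar_prod_def atLeast0LessThan)
  qed
  have frob': "(\<Sum>i<n. \<Sum>j<n. (a i * a j + b i * b j + c i * c j) * (a i * a j + b i * b j + c i * c j))
      = 48 * int t * int t + 24 * int t + 9"
    using frob by (simp add: Gabc)
  have "\<exists>a' b' c'. (\<forall>i<n. \<bar>a' i\<bar> = 1 \<and> \<bar>b' i\<bar> = 1 \<and> \<bar>c' i\<bar> = 1) \<and>
      (\<forall>i<n. \<forall>j<n. (if i = j then 4 * int t + 3 else 0) + (\<Sum>k<n. s i k * s k j)
        = a' i * a' j + b' i * b' j + c' i * c' j) \<and>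
      (\<forall>i<n. (\<Sum>j<n. s i j * a' j) = b' i - c' i) \<and> (\<Sum>i<n. b' i * c' i) = 1"
    by (rule skew_switching_vectors[OF t n_def skew Gabc[unfolded G_def] signs frob' ker i0])
  then obtain a' b' c' where signs': "\<And>i. i < n \<Longrightarrow> \<bar>a' i\<bar> = 1 \<and> \<bar>b' i\<bar> = 1 \<and> \<bar>c' i\<bar> = 1"
    and G': "\<And>i j. i < n \<Longrightarrow> j < n \<Longrightarrow>
      (if i = j then 4 * int t + 3 else 0) + (\<Sum>k<n. s i k * s k j) = a' i * a' j + b' i * b' j + c' i * c' j"
    and Sa: "\<And>i. i < n \<Longrightarrow> (\<Sum>j<n. s i j * a' j) = b' i - c' i" and bc: "(\<Sum>i<n. b' i * c' i) = 1"
    by blast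
  define x where "x = vec n (\<lambda>i. complex_of_int (a' i))"
  have "x $ i \<in> {1, -1}" if "i < n" for i
    using signs'[OF that] that unfolding x_def by (auto simp: abs_if split: if_splits)
  moreover have "x \<in> carrier_vec n" unfolding x_def by simp
  moreover define B where "B = four_block_mat S (transpose_mat (mat_of_row x)) (- mat_of_row x) (0\<^sub>m 1 1)"
  moreover have "skew_seidel_mat B"
    unfolding B_def x_def by (rule bordered_skew_seidel(1)[OF t n_def S entries skew unit signs' G' Sa bc])
  moreover have "mult_spectrum B = pm_mult (csqrt (- 4 * of_nat t - 3)) (2 * t) \<union> pm_mult (csqrt (- 1)) 1"
    unfolding B_def x_def by (rule bordered_skew_seidel(2)[OF t n_def S entries skew unit signs' G' Sa bc])
  ultimately show ?thesis
    unfolding Let_def n_def[symmetric] by blast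
qed

end
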